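(* Let $m$ be an odd positive integer and let $\mathcal{H}_m:=\{\langle\sigma_{2m}^m\rangle,\langle\tau_{2m}\rangle\}$, a set of subgroups of $D_{2m}$. Then the $D_{2m}$-lattice $J_{D_{2m}/\mathcal{H}_m}$ is quasi-permutation.
   Context: $D_{n}:=\langle\sigma_n,\tau_n\mid\sigma_n^n=\tau_n^2=1,\ \tau_n\sigma_n\tau_n^{-1}=\sigma_n^{-1}\rangle$ is the dihedral group of order $2n$; here $n=2m$. A $G$-lattice is a finitely generated free abelian group with left $G$-action; $M^\circ:=\mathrm{Hom}_{\mathbb{Z}}(M,\mathbb{Z})$ with $(gf)(x)=f(g^{-1}x)$. Permutation: has a $\mathbb{Z}$-basis permuted by $G$; quasi-permutation: there is an exact sequence $0\to M\to R\to F\to0$ with $R,F$ permutation. For a set $\mathcal{H}$ of subgroups, $I_{G/\mathcal{H}}:=\ker(\bigoplus_{H\in\mathcal{H}}\mathbb{Z}[G/H]\to\mathbb{Z})$ (sum of augmentation maps) and $J_{G/\mathcal{H}}:=I_{G/\mathcal{H}}^\circ$. *)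

theory Defs
  imports "HOL-Algebra.Coset" "HOL-Algebra.Generated_Groups" "HOL-Library.Function_Algebras"
begin

text \<open>Concrete model of D_n (n >= 1): the pair (a, e) stands for sigma^a tau^e,
  with 0 <= a < n and e in {0,1}.  Multiplication uses tau sigma tau^-1 = sigma^-1.\<close>

definition dihedral :: "nat \<Rightarrow> (int \<times> int) monoid" where
  "dihedral n = \<lparr> carrier = {0..<int n} \<times> {0..<2},
     mult = (\<lambda>(a, e) (b, f). ((a + (if e = 0 then b else - b)) mod int n, (e + f) mod 2)),
     one = (0, 0) \<rparr>"

definition dih_sigma :: "nat \<Rightarrow> int \<times> int" where
  "dih_sigma n = (1 mod int n, 0)"

definition dih_tau :: "nat \<Rightarrow> int \<times> int" where
  "dih_tau n = (0, 1)"

text \<open>A lattice is a subgroup L of a function space 'x => int; Z-linear combinations:\<close>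

definition zlincomb :: "(('x \<Rightarrow> int) \<Rightarrow> int) \<Rightarrow> ('x \<Rightarrow> int) set \<Rightarrow> ('x \<Rightarrow> int)" where
  "zlincomb c B = (\<lambda>y. \<Sum>b\<in>B. c b * b y)"

definition is_Zbasis :: "('x \<Rightarrow> int) set \<Rightarrow> ('x \<Rightarrow> int) set \<Rightarrow> bool" where
  "is_Zbasis L B \<longleftrightarrow> finite B \<and> B \<subseteq> L
     \<and> (\<forall>c. zlincomb c B = 0 \<longrightarrow> (\<forall>b\<in>B. c b = 0))
     \<and> L = range (\<lambda>c. zlincomb c B)"

definition G_lattice :: "('g, 'm) monoid_scheme \<Rightarrow> ('x \<Rightarrow> int) set
      \<Rightarrow> ('g \<Rightarrow> ('x \<Rightarrow> int) \<Rightarrow> ('x \<Rightarrow> int)) \<Rightarrow> bool" where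
  "G_lattice G L act \<longleftrightarrow> group G \<and> (\<exists>B. is_Zbasis L B)
     \<and> (\<forall>g\<in>carrier G. \<forall>x\<in>L. act g x \<in> L)
     \<and> (\<forall>g\<in>carrier G. \<forall>x\<in>L. \<forall>y\<in>L. act g (x + y) = act g x + act g y)
     \<and> (\<forall>x\<in>L. act \<one>\<^bsub>G\<^esub> x = x)
     \<and> (\<forall>g\<in>carrier G. \<forall>h\<in>carrier G. \<forall>x\<in>L. act (g \<otimes>\<^bsub>G\<^esub> h) x = act g (act h x))"

definition permutation_lattice :: "('g, 'm) monoid_scheme \<Rightarrow> ('x \<Rightarrow> int) set
      \<Rightarrow> ('g \<Rightarrow> ('x \<Rightarrow> int) \<Rightarrow> ('x \<Rightarrow> int)) \<Rightarrow> bool" where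
  "permutation_lattice G L act \<longleftrightarrow> G_lattice G L act
     \<and> (\<exists>B. is_Zbasis L B \<and> (\<forall>g\<in>carrier G. \<forall>b\<in>B. act g b \<in> B))"

definition G_hom :: "('g, 'm) monoid_scheme
      \<Rightarrow> ('x \<Rightarrow> int) set \<Rightarrow> ('g \<Rightarrow> ('x \<Rightarrow> int) \<Rightarrow> ('x \<Rightarrow> int))
      \<Rightarrow> ('y \<Rightarrow> int) set \<Rightarrow> ('g \<Rightarrow> ('y \<Rightarrow> int) \<Rightarrow> ('y \<Rightarrow> int))
      \<Rightarrow> (('x \<Rightarrow> int) \<Rightarrow> ('y \<Rightarrow> int)) \<Rightarrow> bool" where
  "G_hom G L1 act1 L2 act2 f \<longleftrightarrow> (\<forall>x\<in>L1. f x \<in> L2)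
     \<and> (\<forall>x\<in>L1. \<forall>y\<in>L1. f (x + y) = f x + f y)
     \<and> (\<forall>g\<in>carrier G. \<forall>x\<in>L1. f (act1 g x) = act2 g (f x))"

text \<open>Quasi-permutation: a short exact sequence 0 -> M -> R -> F -> 0 of G-lattices with R, F
  permutation.  R and F are realised inside nat => int (every G-lattice is isomorphic to one of
  this form).\<close>
definition quasi_permutation :: "('g, 'm) monoid_scheme \<Rightarrow> ('x \<Rightarrow> int) set
      \<Rightarrow> ('g \<Rightarrow> ('x \<Rightarrow> int) \<Rightarrow> ('x \<Rightarrow> int)) \<Rightarrow> bool" where
  "quasi_permutation G M act \<longleftrightarrow> G_lattice G M act \<and>
     (\<exists>(R :: (nat \<Rightarrow> int) set) actR (F :: (nat \<Rightarrow> int) set) actF i p.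
        permutation_lattice G R actR \<and> permutation_lattice G F actF
        \<and> G_hom G M act R actR i \<and> G_hom G R actR F actF p
        \<and> inj_on i M \<and> p ` R = F \<and> i ` M = {y \<in> R. p y = 0})"

text \<open>M^o = Hom_Z(M, Z), realised as additive functions on M which vanish off M;
  (g f)(x) = f(g^-1 x).\<close>
definition dual_lattice :: "('x \<Rightarrow> int) set \<Rightarrow> (('x \<Rightarrow> int) \<Rightarrow> int) set" where
  "dual_lattice L = {\<phi>. (\<forall>x\<in>L. \<forall>y\<in>L. \<phi> (x + y) = \<phi> x + \<phi> y) \<and> (\<forall>x. x \<notin> L \<longrightarrow> \<phi> x = 0)}"

definition dual_act :: "('g, 'm) monoid_scheme \<Rightarrow> ('x \<Rightarrow> int) set
      \<Rightarrow> ('g \<Rightarrow> ('x \<Rightarrow> int) \<Rightarrow> ('x \<Rightarrow> int))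
      \<Rightarrow> 'g \<Rightarrow> (('x \<Rightarrow> int) \<Rightarrow> int) \<Rightarrow> (('x \<Rightarrow> int) \<Rightarrow> int)" where
  "dual_act G L act g \<phi> = (\<lambda>x. if x \<in> L then \<phi> (act (inv\<^bsub>G\<^esub> g) x) else 0)"

text \<open>Index set of the direct sum of the Z[G/H], H in \<H>: pairs (H, gH) of a subgroup in \<H>
  and a left coset of it.\<close>
definition coset_index :: "('g, 'm) monoid_scheme \<Rightarrow> 'g set set \<Rightarrow> ('g set \<times> 'g set) set" where
  "coset_index G \<H> = {(H, C). H \<in> \<H> \<and> (\<exists>g\<in>carrier G. C = g <#\<^bsub>G\<^esub> H)}"

definition perm_sum_lattice :: "('g, 'm) monoid_scheme \<Rightarrow> 'g set set
      \<Rightarrow> ('g set \<times> 'g set \<Rightarrow> int) set" where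
  "perm_sum_lattice G \<H> = {f. \<forall>i. i \<notin> coset_index G \<H> \<longrightarrow> f i = 0}"

definition perm_sum_act :: "('g, 'm) monoid_scheme \<Rightarrow> 'g set set
      \<Rightarrow> 'g \<Rightarrow> ('g set \<times> 'g set \<Rightarrow> int) \<Rightarrow> ('g set \<times> 'g set \<Rightarrow> int)" where
  "perm_sum_act G \<H> g f = (\<lambda>(H, C). if (H, C) \<in> coset_index G \<H>
      then f (H, inv\<^bsub>G\<^esub> g <#\<^bsub>G\<^esub> C) else 0)"

definition I_lattice :: "('g, 'm) monoid_scheme \<Rightarrow> 'g set set \<Rightarrow> ('g set \<times> 'g set \<Rightarrow> int) set" where
  "I_lattice G \<H> = {f \<in> perm_sum_lattice G \<H>. (\<Sum>i\<in>coset_index G \<H>. f i) = 0}"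

definition J_lattice :: "('g, 'm) monoid_scheme \<Rightarrow> 'g set set
      \<Rightarrow> (('g set \<times> 'g set \<Rightarrow> int) \<Rightarrow> int) set" where
  "J_lattice G \<H> = dual_lattice (I_lattice G \<H>)"

definition J_act :: "('g, 'm) monoid_scheme \<Rightarrow> 'g set set
      \<Rightarrow> 'g \<Rightarrow> (('g set \<times> 'g set \<Rightarrow> int) \<Rightarrow> int) \<Rightarrow> (('g set \<times> 'g set \<Rightarrow> int) \<Rightarrow> int)" where
  "J_act G \<H> = dual_act G (I_lattice G \<H>) (perm_sum_act G \<H>)"

end

theory Submission
  imports Defs "HOL-Algebra.Left_Coset" "HOL-Library.Countable"
begin

text \<open>
  Since \<open>m\<close> is odd, \<open>D\<^bsub>2m\<^esub> = \<langle>s, t\<rangle> \<times> \<langle>z\<rangle>\<close> with \<open>z = \<sigma>\<^sup>m\<close>, \<open>t = \<tau>\<close> and \<open>s\<close> of order \<open>m\<close>.  An element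
  of \<open>J\<close> is a pair \<open>\<psi> = (X, Y)\<close> of functions on \<open>G\<close>, right invariant under \<open>z\<close> and \<open>t\<close>
  respectively, taken modulo common constants.  Then \<open>0 \<rightarrow> J \<rightarrow> R \<rightarrow> F \<rightarrow> 0\<close> is exact for
  \<open>R = \<int>[G] \<oplus> \<int>[G/\<langle>z\<rangle>] \<oplus> \<int>\<close>, \<open>F = \<int>[G/\<langle>tz\<rangle>] \<oplus> \<int>[G/\<langle>\<sigma>\<rangle>]\<close> and the maps

  \<^item> \<open>\<psi> \<mapsto> (X - Y, U X, n)\<close> with \<open>U X (x) = \<Sum>\<^bsub>0<i<m\<^esub> (-1)\<^sup>i X(x s\<^sup>i)\<close> and \<open>2n = \<Sum>\<^bsub>G\<^esub> (X - Y)\<close>;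
  \<^item> \<open>(a, b, n) \<mapsto> (A, C)\<close> with
    \<open>A(x) = a(x) + a(x tz) + \<Sum>\<^bsub>i odd\<^esub> \<Sum>\<^bsub>v\<in>\<langle>t,z\<rangle>\<^esub> a(x v s\<^sup>i) + b(x) + b(xt) - n\<close> and
    \<open>C(x) = l \<Sum>\<^bsub>G\<^esub> a + \<Sum>\<^bsub>j\<^esub> b(x s\<^sup>j) - 2 l n\<close>, where \<open>m - 4 l = \<plusminus>1\<close>.

  Exactness rests on two facts: the operator \<open>U\<close> satisfies \<open>U (1 + S) = 1 - S\<close> for the shift \<open>S\<close>
  by \<open>s\<close>, so its image consists of all functions of sum zero and its kernel of the constants;
  and the equations in \<open>n\<close> left over once \<open>a\<close> has been removed have determinant
  \<open>m - 4 l\<close>, a unit.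
\<close>

section \<open>Permutation lattices of coset functions\<close>

text \<open>Evaluation at the points \<open>pt a\<close> is dual to the family \<open>e\<close> and
  so reads off coefficients: this gives injectivity of \<open>e\<close>, independence and, through
  \<open>expand\<close>, spanning. It serves both for coset functions and for
  \<open>J\<close>.\<close>

lemma is_Zbasis_image:
  fixes e :: "'a \<Rightarrow> 'x \<Rightarrow> int"
  assumes fin: "finite A"
    and dual: "\<And>a a'. a \<in> A \<Longrightarrow> a' \<in> A \<Longrightarrow> e a (pt a') = of_bool (a = a')"
    and mem: "\<And>c. (\<lambda>y. \<Sum>a\<in>A. c a * e a y) \<in> L"
    and expand: "\<And>f. f \<in> L \<Longrightarrow> f = (\<lambda>y. \<Sum>a\<in>A. f (pt a) * e a y)"
  shows "is_Zbasis L (e ` A)"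
proof -
  have inj: "inj_on e A"
  proof (rule inj_onI)
    fix a a' assume "a \<in> A" "a' \<in> A" "e a = e a'"
    then show "a = a'" using dual[of a a'] dual[of a' a'] by (cases "a = a'") auto
  qed
  have lc: "zlincomb c (e ` A) = (\<lambda>y. \<Sum>a\<in>A. c (e a) * e a y)" for c
    by (simp add: zlincomb_def sum.reindex[OF inj])
  have eL: "e a \<in> L" if "a \<in> A" for a
  proof -
    have "(\<lambda>y. \<Sum>a'\<in>A. of_bool (a' = a) * e a' y) = e a"
    proof
      fix y
      have "(\<Sum>a'\<in>A. of_bool (a' = a) * e a' y) = (\<Sum>a'\<in>A. if a' = a then e a y else 0)"
        by (rule sum.cong) auto
      then show "(\<Sum>a'\<in>A. of_bool (a' = a) * e a' y) = e a y"
        using that fin by simp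
    qed
    with mem[of "\<lambda>a'. of_bool (a' = a)"] show ?thesis by simp
  qed
  have ev: "(\<Sum>a\<in>A. c a * e a (pt a')) = c a'" if "a' \<in> A" for c a'
  proof -
    have "(\<Sum>a\<in>A. c a * e a (pt a')) = (\<Sum>a\<in>A. if a = a' then c a' else 0)"
      by (rule sum.cong) (auto simp: dual that)
    then show ?thesis using that fin by simp
  qed
  show ?thesis
    unfolding is_Zbasis_def
  proof (intro conjI allI impI ballI)
    show "finite (e ` A)" "e ` A \<subseteq> L" using fin eL by auto
  next
    fix c b assume z: "zlincomb c (e ` A) = 0" and "b \<in> e ` A"
    then obtain a' where a': "a' \<in> A" "b = e a'" by auto
    have "zlincomb c (e ` A) (pt a') = 0" using z by simp
    then show "c b = 0" using ev[OF a'(1), of "\<lambda>a. c (e a)"] by (simp add: lc a'(2))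
  next
    show "L = range (\<lambda>c. zlincomb c (e ` A))"
    proof
      show "range (\<lambda>c. zlincomb c (e ` A)) \<subseteq> L" using mem by (auto simp: lc)
      show "L \<subseteq> range (\<lambda>c. zlincomb c (e ` A))"
      proof
        fix f assume f: "f \<in> L"
        have "f = zlincomb (\<lambda>b. f (pt (inv_into A e b))) (e ` A)"
          unfolding lc using expand[OF f] inj by (simp cong: sum.cong)
        then show "f \<in> range (\<lambda>c. zlincomb c (e ` A))" by blast
      qed
    qed
  qed
qed

section \<open>Transport of lattices to the index type \<open>nat\<close>\<close>

definition nat_copy :: "('a::countable \<Rightarrow> int) set \<Rightarrow> (nat \<Rightarrow> int) set" where
  "nat_copy L = (\<lambda>f. f \<circ> from_nat) ` L"

definition nat_copy_act ::
    "('g \<Rightarrow> ('a::countable \<Rightarrow> int) \<Rightarrow> ('a \<Rightarrow> int)) \<Rightarrow> 'g \<Rightarrow> (nat \<Rightarrow> int) \<Rightarrow> (nat \<Rightarrow> int)" where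
  "nat_copy_act act g h = act g (h \<circ> to_nat) \<circ> from_nat"

lemma from_nat_to_nat_comp [simp]:
  fixes f :: "'a::countable \<Rightarrow> 'b"
  shows "f \<circ> from_nat \<circ> to_nat = f"
  by (auto simp: fun_eq_iff)

lemma nat_copy_act_comp [simp]: "nat_copy_act act g (f \<circ> from_nat) = act g f \<circ> from_nat"
  by (simp add: nat_copy_act_def)

lemma comp_from_nat_eq_iff [simp]:
  fixes f g :: "'a::countable \<Rightarrow> 'b"
  shows "f \<circ> from_nat = g \<circ> from_nat \<longleftrightarrow> f = g"
  by (metis from_nat_to_nat_comp)

lemma comp_from_nat_add:
  fixes f g :: "'a::countable \<Rightarrow> int"
  shows "(f \<circ> from_nat) + (g \<circ> from_nat) = (f + g) \<circ> from_nat"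
  by (auto simp: fun_eq_iff)

lemma comp_from_nat_eq_0_iff [simp]:
  fixes f :: "'a::countable \<Rightarrow> int"
  shows "f \<circ> from_nat = 0 \<longleftrightarrow> f = 0"
proof -
  have "(0 :: 'a \<Rightarrow> int) \<circ> from_nat = 0" by (auto simp: fun_eq_iff)
  then show ?thesis using comp_from_nat_eq_iff[of f 0] by simp
qed

lemma is_Zbasis_nat_copy:
  assumes "is_Zbasis L B"
  shows "is_Zbasis (nat_copy L) ((\<lambda>f. f \<circ> from_nat) ` B)"
proof -
  let ?T = "\<lambda>f :: 'a \<Rightarrow> int. f \<circ> from_nat"
  have inj: "inj_on ?T B" by (auto intro: inj_onI)
  have lc: "zlincomb c (?T ` B) = zlincomb (\<lambda>b. c (?T b)) B \<circ> from_nat" for c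
    by (simp add: zlincomb_def sum.reindex[OF inj] fun_eq_iff)
  have L: "L = range (\<lambda>c. zlincomb c B)" using assms by (simp add: is_Zbasis_def)
  have "nat_copy L = range (\<lambda>c. zlincomb c (?T ` B))"
  proof -
    have "zlincomb c B \<circ> from_nat = zlincomb (\<lambda>h. c (h \<circ> to_nat)) (?T ` B)" for c
      by (simp add: lc)
    then show ?thesis unfolding nat_copy_def L by (fastforce simp: lc)
  qed
  moreover have "?T ` B \<subseteq> nat_copy L" using assms by (auto simp: is_Zbasis_def nat_copy_def)
  moreover have "finite (?T ` B)" using assms by (simp add: is_Zbasis_def)
  moreover have "\<forall>c. zlincomb c (?T ` B) = 0 \<longrightarrow> (\<forall>b\<in>?T ` B. c b = 0)"
    using assms by (auto simp: is_Zbasis_def lc)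
  ultimately show ?thesis unfolding is_Zbasis_def by blast
qed

lemma permutation_lattice_nat_copy:
  assumes "permutation_lattice G L act"
  shows "permutation_lattice G (nat_copy L) (nat_copy_act act)"
proof -
  have gl: "G_lattice G L act" using assms by (simp add: permutation_lattice_def)
  obtain B where B: "is_Zbasis L B" "\<forall>g\<in>carrier G. \<forall>b\<in>B. act g b \<in> B"
    using assms by (auto simp: permutation_lattice_def)
  have "G_lattice G (nat_copy L) (nat_copy_act act)"
    using gl is_Zbasis_nat_copy[OF B(1)] unfolding G_lattice_def
    by (auto simp: nat_copy_def comp_from_nat_add)
  moreover have "\<forall>g\<in>carrier G. \<forall>b\<in>(\<lambda>f. f \<circ> from_nat) ` B. nat_copy_act act g b \<in> (\<lambda>f. f \<circ> from_nat) ` B"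
    using B(2) by auto
  ultimately show ?thesis
    using is_Zbasis_nat_copy[OF B(1)] unfolding permutation_lattice_def by blast
qed

text \<open>The definition of \<open>quasi_permutation\<close> fixes the index type
  \<open>nat\<close>. Precomposition with the surjection \<open>from_nat\<close> is injective and is
  undone by precomposition with \<open>to_nat\<close>, so a resolution over any countable index
  types can be copied.\<close>

lemma quasi_permutation_countableI:
  fixes R :: "('a::countable \<Rightarrow> int) set" and F :: "('b::countable \<Rightarrow> int) set"
  assumes "G_lattice G M act" "permutation_lattice G R actR" "permutation_lattice G F actF"
    and i: "G_hom G M act R actR i" and p: "G_hom G R actR F actF p"
    and ex: "inj_on i M" "p ` R = F" "i ` M = {y \<in> R. p y = 0}"
  shows "quasi_permutation G M act"
proof -
  let ?i = "\<lambda>x. i x \<circ> from_nat"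
  let ?p = "\<lambda>h. p (h \<circ> to_nat) \<circ> from_nat :: nat \<Rightarrow> int"
  have "G_hom G M act (nat_copy R) (nat_copy_act actR) ?i"
    using i by (auto simp: G_hom_def nat_copy_def comp_from_nat_add)
  moreover have "G_hom G (nat_copy R) (nat_copy_act actR) (nat_copy F) (nat_copy_act actF) ?p"
    using p by (auto simp: G_hom_def nat_copy_def comp_from_nat_add)
  moreover have "inj_on ?i M" using ex(1) by (auto simp: inj_on_def)
  moreover have "?p ` nat_copy R = nat_copy F"
    by (simp add: nat_copy_def image_image flip: ex(2))
  moreover have "?i ` M = {y \<in> nat_copy R. ?p y = 0}"
  proof -
    have "?i ` M = (\<lambda>f. f \<circ> from_nat) ` (i ` M)" by (simp add: image_image)
    also have "\<dots> = {y \<in> nat_copy R. ?p y = 0}"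
      unfolding ex(3) by (auto simp: nat_copy_def)
    finally show ?thesis .
  qed
  ultimately show ?thesis
    unfolding quasi_permutation_def
    using assms(1) permutation_lattice_nat_copy[OF assms(2)] permutation_lattice_nat_copy[OF assms(3)]
    by blast
qed

section \<open>Sums of lattices \<open>Z[G/H]\<close> as right invariant functions\<close>

definition coset_fun_lattice ::
    "('g, 'm) monoid_scheme \<Rightarrow> 'k set \<Rightarrow> ('k \<Rightarrow> 'g set) \<Rightarrow> ('k \<times> 'g \<Rightarrow> int) set" where
  "coset_fun_lattice G K H = {f. (\<forall>k x. k \<notin> K \<or> x \<notin> carrier G \<longrightarrow> f (k, x) = 0)
     \<and> (\<forall>k\<in>K. \<forall>x\<in>carrier G. \<forall>h\<in>H k. f (k, x \<otimes>\<^bsub>G\<^esub> h) = f (k, x))}"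

lemma coset_fun_lattice_add:
    "f \<in> coset_fun_lattice G K H \<Longrightarrow> f' \<in> coset_fun_lattice G K H \<Longrightarrow> f + f' \<in> coset_fun_lattice G K H"
  and coset_fun_lattice_diff:
    "f \<in> coset_fun_lattice G K H \<Longrightarrow> f' \<in> coset_fun_lattice G K H \<Longrightarrow> f - f' \<in> coset_fun_lattice G K H"
  by (simp_all add: coset_fun_lattice_def)

definition translate :: "('g, 'm) monoid_scheme \<Rightarrow> 'g \<Rightarrow> ('k \<times> 'g \<Rightarrow> int) \<Rightarrow> ('k \<times> 'g \<Rightarrow> int)" where
  "translate G g f = (\<lambda>(k, x). if x \<in> carrier G then f (k, inv\<^bsub>G\<^esub> g \<otimes>\<^bsub>G\<^esub> x) else 0)"

lemma (in group) mem_l_coset_iff: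
  assumes "subgroup H G" "x \<in> carrier G" "y \<in> carrier G"
  shows "x \<in> y <# H \<longleftrightarrow> inv y \<otimes> x \<in> H"
proof
  assume "x \<in> y <# H"
  then obtain h where "h \<in> H" "x = y \<otimes> h" by (auto simp: l_coset_def)
  then show "inv y \<otimes> x \<in> H"
    using assms by (simp add: subgroup.mem_carrier m_assoc[symmetric])
next
  assume "inv y \<otimes> x \<in> H"
  moreover have "x = y \<otimes> (inv y \<otimes> x)" using assms by (simp add: m_assoc[symmetric])
  ultimately show "x \<in> y <# H" by (auto simp: l_coset_def)
qed

lemma (in group) l_coset_eq:
  assumes "subgroup H G" "y \<in> carrier G" "x \<in> y <# H"
  shows "x <# H = y <# H"
  using l_repr_independence[OF assms(3,2,1)] by simp

text \<open>The indicators of the left cosets form a basis, and translation by \<open>g\<close>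
  takes the indicator of \<open>y <# H k\<close> to that of \<open>(g \<otimes> y) <# H k\<close>.
  Using invariant functions on \<open>G\<close>, not functions on cosets, lets the later formulas be
  evaluated at group elements.\<close>

lemma (in group) permutation_lattice_coset_fun:
  fixes K :: "'k set" and H :: "'k \<Rightarrow> 'a set"
  assumes fin: "finite (carrier G)" "finite K" and sub: "\<And>k. k \<in> K \<Longrightarrow> subgroup (H k) G"
  shows "permutation_lattice G (coset_fun_lattice G K H) (translate G)"
proof -
  define L where "L = coset_fun_lattice G K H"
  define A where "A = (SIGMA k:K. (\<lambda>x. x <# H k) ` carrier G)"
  define e :: "'k \<times> 'a set \<Rightarrow> 'k \<times> 'a \<Rightarrow> int" where
    "e = (\<lambda>(k, C) (k', x). of_bool (k' = k \<and> x \<in> C))"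
  \<comment> \<open>An invariant function is determined by its value at one chosen representative of
    each coset; these are the dual points.\<close>
  define pt where "pt = (\<lambda>(k :: 'k, C :: 'a set). (k, SOME x. x \<in> C))"
  have cc: "x \<in> carrier G" if "x \<in> y <# H k" "y \<in> carrier G" "k \<in> K" for x y k
    using l_coset_carrier[OF that(1,2) sub[OF that(3)]] .
  have rep: "(SOME x. x \<in> C) \<in> C" "(SOME x. x \<in> C) \<in> carrier G" "(SOME x. x \<in> C) <# H k = C"
    if kC: "(k, C) \<in> A" for k C
  proof -
    obtain y where y: "k \<in> K" "y \<in> carrier G" "C = y <# H k" using kC by (auto simp: A_def)
    have "y \<in> C" using y lcos_self[OF y(2) sub] by simp
    then show *: "(SOME x. x \<in> C) \<in> C" by (rule someI)
    then show "(SOME x. x \<in> C) \<in> carrier G" using cc y by blast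
    show "(SOME x. x \<in> C) <# H k = C" using l_coset_eq[OF sub y(2)] * y by blast
  qed
  have uniq: "C = x <# H k" if "(k, C) \<in> A" "x \<in> C" for k C x
    using that l_coset_eq[OF sub] by (auto simp: A_def)
  have AI: "(k, x <# H k) \<in> A" if "k \<in> K" "x \<in> carrier G" for k x
    using that by (auto simp: A_def)
  have finA: "finite A" unfolding A_def using fin by auto
  have basis: "is_Zbasis L (e ` A)"
  proof (rule is_Zbasis_image[where pt = pt])
    show "finite A" by (fact finA)
  next
    fix a a' assume "a \<in> A" "a' \<in> A"
    moreover have "b = b'" if "(k, b) \<in> A" "(k, b') \<in> A" "(SOME x. x \<in> b') \<in> b" for k b b'
      using uniq[OF that(1,3)] uniq[OF that(2) rep(1)[OF that(2)]] by simp
    ultimately show "e a (pt a') = of_bool (a = a')"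
      using rep(1) by (cases a; cases a') (auto simp: e_def pt_def)
  next
    fix c :: "'k \<times> 'a set \<Rightarrow> int"
    show "(\<lambda>y. \<Sum>a\<in>A. c a * e a y) \<in> L"
      unfolding L_def coset_fun_lattice_def
    proof (intro CollectI conjI allI impI ballI)
      fix k x assume "k \<notin> K \<or> x \<notin> carrier G"
      then have "e a (k, x) = 0" if "a \<in> A" for a
        using that by (auto simp: A_def e_def dest: cc)
      then show "(\<Sum>a\<in>A. c a * e a (k, x)) = 0" by simp
    next
      fix k x h assume k: "k \<in> K" "x \<in> carrier G" "h \<in> H k"
      have xh: "x \<otimes> h \<in> x <# H k" using k by (auto simp: l_coset_def)
      have xx: "x \<in> x <# H k" using lcos_self[OF k(2) sub[OF k(1)]] .
      have "(x \<otimes> h) <# H k = x <# H k" by (rule l_coset_eq[OF sub[OF k(1)] k(2) xh])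
      then have "e a (k, x \<otimes> h) = e a (k, x)" if "a \<in> A" for a
        using that uniq xx xh by (cases a) (auto simp: e_def)
      then show "(\<Sum>a\<in>A. c a * e a (k, x \<otimes> h)) = (\<Sum>a\<in>A. c a * e a (k, x))" by simp
    qed
  next
    fix f assume f: "f \<in> L"
    show "f = (\<lambda>y. \<Sum>a\<in>A. f (pt a) * e a y)"
    proof
      fix y :: "'k \<times> 'a"
      obtain k x where y: "y = (k, x)" by (cases y)
      show "f y = (\<Sum>a\<in>A. f (pt a) * e a y)"
      proof (cases "k \<in> K \<and> x \<in> carrier G")
        case False
        then have "e a (k, x) = 0" if "a \<in> A" for a
          using that by (auto simp: A_def e_def dest: cc)
        moreover have "f (k, x) = 0" using f False by (auto simp: L_def coset_fun_lattice_def)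
        ultimately show ?thesis by (simp add: y)
      next
        case True
        then have a0: "(k, x <# H k) \<in> A" (is "?a \<in> A") by (auto intro: AI)
        have xx: "x \<in> x <# H k" using True by (auto intro: lcos_self sub)
        have "(\<Sum>a\<in>A. f (pt a) * e a y) = (\<Sum>a\<in>A. if a = ?a then f (pt ?a) else 0)"
        proof (rule sum.cong)
          fix a assume "a \<in> A"
          then show "f (pt a) * e a y = (if a = ?a then f (pt ?a) else 0)"
            using uniq xx by (cases a) (auto simp: e_def y)
        qed simp
        also have "\<dots> = f (pt ?a)" using a0 finA by simp
        also have "\<dots> = f y"
        proof -
          obtain h where "h \<in> H k" "(SOME w. w \<in> x <# H k) = x \<otimes> h"
            using rep(1)[OF a0] by (auto simp: l_coset_def)
          then show ?thesis using f True by (auto simp: L_def coset_fun_lattice_def pt_def y)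
        qed
        finally show ?thesis by simp
      qed
    qed
  qed
  have act: "translate G g (e a) \<in> e ` A" if g: "g \<in> carrier G" and a: "a \<in> A" for g a
  proof -
    obtain k y where y: "k \<in> K" "y \<in> carrier G" "a = (k, y <# H k)" using a by (auto simp: A_def)
    have "inv g \<otimes> x \<in> y <# H k \<longleftrightarrow> x \<in> (g \<otimes> y) <# H k" if x: "x \<in> carrier G" for x
      using g x y by (simp add: mem_l_coset_iff sub inv_mult_group m_assoc)
    moreover have "x \<in> carrier G" if "x \<in> (g \<otimes> y) <# H k" for x
      using cc[OF that] g y by auto
    ultimately have "translate G g (e a) = e (k, (g \<otimes> y) <# H k)"
      by (auto simp: translate_def e_def y fun_eq_iff)
    then show ?thesis using AI[OF y(1), of "g \<otimes> y"] g y by auto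
  qed
  have "G_lattice G L (translate G)"
    unfolding G_lattice_def
  proof (intro conjI ballI)
    show "group G" by (rule group_axioms)
    show "\<exists>B. is_Zbasis L B" using basis by blast
  next
    fix g f assume "g \<in> carrier G" "f \<in> L"
    moreover have "h \<in> carrier G" if "k \<in> K" "h \<in> H k" for k h
      using subgroup.mem_carrier[OF sub] that by blast
    ultimately show "translate G g f \<in> L"
      by (auto simp: L_def coset_fun_lattice_def translate_def simp flip: m_assoc)
  next
    fix f assume "f \<in> L"
    then show "translate G \<one> f = f"
      by (auto simp: L_def coset_fun_lattice_def translate_def fun_eq_iff)
  qed (auto simp: translate_def fun_eq_iff inv_mult_group m_assoc)
  then show ?thesis
    using basis act unfolding permutation_lattice_def L_def by blast
qed

section \<open>The lattice \<open>J\<close> as a quotient of a permutation lattice\<close>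

text \<open>Additivity on \<open>L\<close> forces compatibility with integer multiples, by induction
  from 0 in both directions, and then with finite combinations.\<close>

lemma dual_lattice_sum:
  fixes L :: "('x \<Rightarrow> int) set"
  assumes zero: "0 \<in> L" and add: "\<And>x y. x \<in> L \<Longrightarrow> y \<in> L \<Longrightarrow> x + y \<in> L"
    and neg: "\<And>x. x \<in> L \<Longrightarrow> - x \<in> L"
    and phi: "\<phi> \<in> dual_lattice L" and "finite A" and v: "\<And>a. a \<in> A \<Longrightarrow> v a \<in> L"
  shows "(\<lambda>y. \<Sum>a\<in>A. c a * v a y) \<in> L
    \<and> \<phi> (\<lambda>y. \<Sum>a\<in>A. c a * v a y) = (\<Sum>a\<in>A. c a * \<phi> (v a))"
proof -
  have phi_add: "\<phi> (x + y) = \<phi> x + \<phi> y" if "x \<in> L" "y \<in> L" for x y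
    using phi that by (simp add: dual_lattice_def)
  have phi_0: "\<phi> 0 = 0" using phi_add[OF zero zero] by simp
  have phi_neg: "\<phi> (- x) = - \<phi> x" if "x \<in> L" for x
    using phi_add[OF that neg[OF that]] phi_0 by simp
  have scale: "(\<lambda>y. n * x y) \<in> L \<and> \<phi> (\<lambda>y. n * x y) = n * \<phi> x" if x: "x \<in> L" for n x
  proof (induction n rule: int_induct[where k = 0])
    case base
    have "(\<lambda>y. 0 * x y) = 0" by (simp add: fun_eq_iff)
    then show ?case using zero phi_0 by simp
  next
    case (step1 i)
    have "(\<lambda>y. (i + 1) * x y) = (\<lambda>y. i * x y) + x" by (simp add: fun_eq_iff algebra_simps)
    then show ?case using step1 x add phi_add by (simp add: algebra_simps)
  next
    case (step2 i)
    have "(\<lambda>y. (i - 1) * x y) = (\<lambda>y. i * x y) + (- x)" by (simp add: fun_eq_iff algebra_simps)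
    then have "(\<lambda>y. (i - 1) * x y) \<in> L" "\<phi> (\<lambda>y. (i - 1) * x y) = i * \<phi> x + \<phi> (- x)"
      using step2 add[OF _ neg[OF x]] phi_add[OF _ neg[OF x]] by simp_all
    then show ?case using phi_neg[OF x] by (simp add: algebra_simps)
  qed
  show ?thesis
    using \<open>finite A\<close> v
  proof (induction A)
    case empty
    have "(\<lambda>y. 0) = (0 :: 'x \<Rightarrow> int)" by (simp add: fun_eq_iff)
    then show ?case using zero phi_0 by simp
  next
    case (insert a A)
    have "(\<lambda>y. \<Sum>a\<in>insert a A. c a * v a y) = (\<lambda>y. c a * v a y) + (\<lambda>y. \<Sum>a\<in>A. c a * v a y)"
      using insert.hyps by (simp add: fun_eq_iff)
    then show ?case using insert scale[of "v a" "c a"] add phi_add by simp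
  qed
qed

section \<open>The permutation lattice on a family of coset spaces\<close>

definition coset_shift :: "('g, 'm) monoid_scheme \<Rightarrow> 'g \<Rightarrow> 'g set \<times> 'g set \<Rightarrow> 'g set \<times> 'g set" where
  "coset_shift G g = (\<lambda>(H, C). (H, g <#\<^bsub>G\<^esub> C))"

locale coset_family = group G for G :: "('g, 'm) monoid_scheme" (structure) +
  fixes \<H> :: "'g set set"
  assumes finite_carrier: "finite (carrier G)"
    and subgroups: "H \<in> \<H> \<Longrightarrow> subgroup H G"
    and nonempty: "\<H> \<noteq> {}"
begin

abbreviation "P \<equiv> coset_index G \<H>"

lemma coset_index_subset: "P \<subseteq> Pow (carrier G) \<times> Pow (carrier G)"
  using subgroups by (auto simp: coset_index_def dest: subgroup.mem_carrier l_coset_carrier)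

lemma finite_coset_index: "finite P"
  by (rule finite_subset[OF coset_index_subset]) (simp add: finite_carrier)

lemma coset_index_nonempty: "P \<noteq> {}"
  using nonempty by (auto simp: coset_index_def)

lemma coset_shift_mult:
  assumes "p \<in> P" "g \<in> carrier G" "h \<in> carrier G"
  shows "coset_shift G (g \<otimes> h) p = coset_shift G g (coset_shift G h p)"
  using assms coset_index_subset by (auto simp: coset_shift_def lcos_m_assoc)

lemma coset_shift_one: "p \<in> P \<Longrightarrow> coset_shift G \<one> p = p"
  using coset_index_subset by (auto simp: coset_shift_def lcos_mult_one)

lemma coset_shift_mem:
  assumes "p \<in> P" "g \<in> carrier G"
  shows "coset_shift G g p \<in> P"
proof -
  obtain H x where p: "H \<in> \<H>" "x \<in> carrier G" "p = (H, x <# H)"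
    using assms(1) by (auto simp: coset_index_def)
  then have "coset_shift G g p = (H, (g \<otimes> x) <# H)"
    using assms(2) subgroup.subset[OF subgroups] by (simp add: coset_shift_def lcos_m_assoc)
  then show ?thesis using p assms(2) by (auto simp: coset_index_def)
qed

lemma bij_betw_coset_shift:
  assumes "g \<in> carrier G"
  shows "bij_betw (coset_shift G g) P P"
  by (rule bij_betwI[where g = "coset_shift G (inv g)"])
    (use assms in \<open>auto simp: coset_shift_mem coset_shift_one simp flip: coset_shift_mult\<close>)

lemma perm_sum_act_eq:
  "perm_sum_act G \<H> g f = (\<lambda>p. if p \<in> P then f (coset_shift G (inv g) p) else 0)"
  by (auto simp: perm_sum_act_def coset_shift_def fun_eq_iff)

lemma sum_coset_shift:
  fixes f :: "'g set \<times> 'g set \<Rightarrow> int"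
  assumes "g \<in> carrier G"
  shows "(\<Sum>p\<in>P. f (coset_shift G g p)) = (\<Sum>p\<in>P. f p)"
  using sum.reindex_bij_betw[OF bij_betw_coset_shift[OF assms]] .

lemma perm_sum_act_mem: "perm_sum_act G \<H> g f \<in> perm_sum_lattice G \<H>"
  by (simp add: perm_sum_act_eq perm_sum_lattice_def)

lemma perm_sum_act_mult:
  assumes "g \<in> carrier G" "h \<in> carrier G"
  shows "perm_sum_act G \<H> (g \<otimes> h) f = perm_sum_act G \<H> g (perm_sum_act G \<H> h f)"
  using assms by (auto simp: perm_sum_act_eq coset_shift_mem coset_shift_mult inv_mult_group fun_eq_iff)

lemma I_lattice_act_mem:
  assumes "g \<in> carrier G" "f \<in> I_lattice G \<H>"
  shows "perm_sum_act G \<H> g f \<in> I_lattice G \<H>"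
  using assms sum_coset_shift[of "inv g" f]
  by (simp add: I_lattice_def perm_sum_act_mem) (simp add: perm_sum_act_eq)

lemma I_lattice_zero: "0 \<in> I_lattice G \<H>"
  and I_lattice_add: "f \<in> I_lattice G \<H> \<Longrightarrow> f' \<in> I_lattice G \<H> \<Longrightarrow> f + f' \<in> I_lattice G \<H>"
  and I_lattice_uminus: "f \<in> I_lattice G \<H> \<Longrightarrow> - f \<in> I_lattice G \<H>"
  by (auto simp: I_lattice_def perm_sum_lattice_def sum.distrib sum_negf)

section \<open>Functionals on sum-zero functions\<close>

definition base :: "'g set \<times> 'g set" where "base = (SOME p. p \<in> P)"

lemma base_mem: "base \<in> P"
  unfolding base_def using coset_index_nonempty by (auto intro: someI_ex)

definition diff_base :: "'g set \<times> 'g set \<Rightarrow> ('g set \<times> 'g set \<Rightarrow> int)" where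
  "diff_base p = (\<lambda>q. of_bool (q = p) - of_bool (q = base))"

lemma diff_base_mem: "p \<in> P \<Longrightarrow> diff_base p \<in> I_lattice G \<H>"
  using base_mem finite_coset_index
  by (auto simp: I_lattice_def perm_sum_lattice_def diff_base_def sum_subtractf of_bool_def)

text \<open>The differences reproduce \<open>f\<close> up to the sum of all its values placed at
  \<open>base\<close>, and that sum is 0.\<close>

lemma I_lattice_expand:
  assumes "f \<in> I_lattice G \<H>"
  shows "f = (\<lambda>q. \<Sum>p\<in>P. f p * diff_base p q)"
proof
  fix q
  have z: "(\<Sum>p\<in>P. f p) = 0" and o: "q \<notin> P \<Longrightarrow> f q = 0"
    using assms unfolding I_lattice_def perm_sum_lattice_def by blast+
  have "(\<Sum>p\<in>P. f p * diff_base p q) = (\<Sum>p\<in>P. if p = q then f q else 0) - (\<Sum>p\<in>P. f p) * of_bool (q = base)"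
    unfolding sum_distrib_right sum_subtractf[symmetric]
    by (rule sum.cong) (auto simp: diff_base_def algebra_simps)
  also have "\<dots> = f q" using z o finite_coset_index by simp
  finally show "f q = (\<Sum>p\<in>P. f p * diff_base p q)" by simp
qed

text \<open>For \<open>\<phi>\<close> in \<open>J\<close> this is the representing function that
  vanishes at \<open>base\<close>, so \<open>potential\<close> is a section of
  \<open>pairing\<close>.\<close>

definition potential :: "(('g set \<times> 'g set \<Rightarrow> int) \<Rightarrow> int) \<Rightarrow> ('g set \<times> 'g set \<Rightarrow> int)" where
  "potential \<phi> = (\<lambda>p. if p \<in> P then \<phi> (diff_base p) else 0)"

definition pairing :: "('g set \<times> 'g set \<Rightarrow> int) \<Rightarrow> (('g set \<times> 'g set \<Rightarrow> int) \<Rightarrow> int)" where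
  "pairing \<psi> = (\<lambda>f. if f \<in> I_lattice G \<H> then \<Sum>p\<in>P. f p * \<psi> p else 0)"

lemma potential_mem: "potential \<phi> \<in> perm_sum_lattice G \<H>"
  by (simp add: potential_def perm_sum_lattice_def)

lemma pairing_mem: "pairing \<psi> \<in> J_lattice G \<H>"
  by (auto simp: pairing_def J_lattice_def dual_lattice_def I_lattice_add sum.distrib algebra_simps)

lemma pairing_potential:
  assumes "\<phi> \<in> J_lattice G \<H>"
  shows "pairing (potential \<phi>) = \<phi>"
proof
  fix f
  show "pairing (potential \<phi>) f = \<phi> f"
  proof (cases "f \<in> I_lattice G \<H>")
    case True
    have "\<phi> f = \<phi> (\<lambda>q. \<Sum>p\<in>P. f p * diff_base p q)" using I_lattice_expand[OF True] by simp
    also have "\<dots> = (\<Sum>p\<in>P. f p * \<phi> (diff_base p))"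
      using dual_lattice_sum[OF I_lattice_zero I_lattice_add I_lattice_uminus
          assms[unfolded J_lattice_def] finite_coset_index, of diff_base f] diff_base_mem by blast
    finally show ?thesis using True by (simp add: pairing_def potential_def)
  next
    case False
    then show ?thesis using assms by (simp add: pairing_def J_lattice_def dual_lattice_def)
  qed
qed

lemma sum_diff_base:
  assumes "p \<in> P"
  shows "(\<Sum>q\<in>P. diff_base p q * \<psi> q) = \<psi> p - \<psi> base"
proof -
  have "(\<Sum>q\<in>P. diff_base p q * \<psi> q)
    = (\<Sum>q\<in>P. if q = p then \<psi> p else 0) - (\<Sum>q\<in>P. if q = base then \<psi> base else 0)"
    unfolding sum_subtractf[symmetric] by (rule sum.cong) (auto simp: diff_base_def)
  then show ?thesis using assms base_mem finite_coset_index by simp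
qed

text \<open>Going to \<open>J\<close> and back changes \<open>\<psi>\<close> on \<open>P\<close>
  only by the constant \<open>\<psi> base\<close>; this is how \<open>J\<close> becomes the
  permutation lattice modulo constants.\<close>

lemma potential_pairing: "potential (pairing \<psi>) = (\<lambda>p. if p \<in> P then \<psi> p - \<psi> base else 0)"
  by (auto simp: potential_def pairing_def diff_base_mem sum_diff_base fun_eq_iff)

text \<open>Reindexing the sum along the bijection \<open>coset_shift G g\<close> moves the action
  of \<open>inv g\<close> on the argument to the action of \<open>g\<close> on
  \<open>\<psi>\<close>.\<close>

lemma J_act_pairing:
  assumes "g \<in> carrier G"
  shows "J_act G \<H> g (pairing \<psi>) = pairing (perm_sum_act G \<H> g \<psi>)"
proof
  fix f
  have "(\<Sum>p\<in>P. f (coset_shift G g p) * \<psi> p) = (\<Sum>p\<in>P. f p * \<psi> (coset_shift G (inv g) p))"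
    using sum_coset_shift[OF assms, of "\<lambda>p. f p * \<psi> (coset_shift G (inv g) p)"] assms
    by (simp add: coset_shift_one cong: sum.cong flip: coset_shift_mult)
  then show "J_act G \<H> g (pairing \<psi>) f = pairing (perm_sum_act G \<H> g \<psi>) f"
    using I_lattice_act_mem[of "inv g" f] assms
    by (simp add: J_act_def dual_act_def pairing_def) (simp add: perm_sum_act_eq)
qed

lemma J_lattice_eq: "J_lattice G \<H> = range pairing"
proof
  show "J_lattice G \<H> \<subseteq> range pairing"
  proof
    fix \<phi> assume "\<phi> \<in> J_lattice G \<H>"
    then show "\<phi> \<in> range pairing" by (metis pairing_potential rangeI)
  qed
qed (auto simp: pairing_mem)

text \<open>This is the basis dual to the \<open>diff_base p\<close>. The index \<open>base\<close>
  is left out because \<open>diff_base base = 0\<close>.\<close>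

lemma is_Zbasis_J_lattice:
  "is_Zbasis (J_lattice G \<H>) ((\<lambda>p. pairing (\<lambda>q. of_bool (q = p))) ` (P - {base}))"
proof (rule is_Zbasis_image[where pt = diff_base])
  show "finite (P - {base})" using finite_coset_index by simp
next
  fix p p' assume "p \<in> P - {base}" "p' \<in> P - {base}"
  then show "pairing (\<lambda>q. of_bool (q = p)) (diff_base p') = of_bool (p = p')"
    by (auto simp: pairing_def diff_base_mem sum_diff_base)
next
  fix c :: "'g set \<times> 'g set \<Rightarrow> int"
  have "(\<lambda>f. \<Sum>p\<in>P - {base}. c p * pairing (\<lambda>q. of_bool (q = p)) f)
    = pairing (\<lambda>q. \<Sum>p\<in>P - {base}. c p * of_bool (q = p))"
  proof
    fix f
    have "(\<Sum>p\<in>P - {base}. c p * (\<Sum>q\<in>P. f q * of_bool (q = p)))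
      = (\<Sum>q\<in>P. f q * (\<Sum>p\<in>P - {base}. c p * of_bool (q = p)))"
      unfolding sum_distrib_left by (subst sum.swap) (simp add: mult.left_commute)
    then show "(\<Sum>p\<in>P - {base}. c p * pairing (\<lambda>q. of_bool (q = p)) f)
      = pairing (\<lambda>q. \<Sum>p\<in>P - {base}. c p * of_bool (q = p)) f"
      by (simp add: pairing_def)
  qed
  then show "(\<lambda>f. \<Sum>p\<in>P - {base}. c p * pairing (\<lambda>q. of_bool (q = p)) f) \<in> J_lattice G \<H>"
    by (simp add: pairing_mem)
next
  fix \<phi> assume phi: "\<phi> \<in> J_lattice G \<H>"
  show "\<phi> = (\<lambda>f. \<Sum>p\<in>P - {base}. \<phi> (diff_base p) * pairing (\<lambda>q. of_bool (q = p)) f)"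
  proof
    fix f
    have 1: "pairing (\<lambda>q. of_bool (q = p)) f = f p" if "p \<in> P" "f \<in> I_lattice G \<H>" for p
      using that finite_coset_index by (simp add: pairing_def of_bool_def if_distrib cong: if_cong)
    have "diff_base base = 0" by (simp add: diff_base_def fun_eq_iff)
    moreover have "\<phi> 0 = 0"
    proof -
      have "\<phi> (0 + 0) = \<phi> 0 + \<phi> 0"
        using phi I_lattice_zero unfolding J_lattice_def dual_lattice_def by blast
      then show ?thesis by simp
    qed
    ultimately have 2: "\<phi> (diff_base base) = 0" by simp
    have "\<phi> f = pairing (potential \<phi>) f" using pairing_potential[OF phi] by simp
    also have "\<dots> = (\<Sum>p\<in>P - {base}. \<phi> (diff_base p) * pairing (\<lambda>q. of_bool (q = p)) f)"
    proof (cases "f \<in> I_lattice G \<H>")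
      case True
      then have "pairing (potential \<phi>) f = (\<Sum>p\<in>P. \<phi> (diff_base p) * f p)"
        by (simp add: pairing_def potential_def mult.commute)
      also have "\<dots> = (\<Sum>p\<in>P - {base}. \<phi> (diff_base p) * f p)"
        using sum.remove[OF finite_coset_index base_mem, of "\<lambda>p. \<phi> (diff_base p) * f p"] 2 by simp
      finally show ?thesis using True by (simp add: 1)
    qed (simp add: pairing_def)
    finally show "\<phi> f = (\<Sum>p\<in>P - {base}. \<phi> (diff_base p) * pairing (\<lambda>q. of_bool (q = p)) f)" .
  qed
qed

lemma G_lattice_J: "G_lattice G (J_lattice G \<H>) (J_act G \<H>)"
  unfolding G_lattice_def
proof (intro conjI ballI)
  show "group G" by (rule group_axioms)
  show "\<exists>B. is_Zbasis (J_lattice G \<H>) B" using is_Zbasis_J_lattice by blast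
next
  fix g \<phi> assume "g \<in> carrier G" "\<phi> \<in> J_lattice G \<H>"
  then show "J_act G \<H> g \<phi> \<in> J_lattice G \<H>" by (auto simp: J_lattice_eq J_act_pairing)
next
  fix \<phi> assume "\<phi> \<in> J_lattice G \<H>"
  then obtain \<psi> where "\<phi> = pairing \<psi>" by (auto simp: J_lattice_eq)
  moreover have "pairing (perm_sum_act G \<H> \<one> \<psi>) = pairing \<psi>"
    by (auto simp: pairing_def perm_sum_act_eq coset_shift_one fun_eq_iff intro!: sum.cong)
  ultimately show "J_act G \<H> \<one> \<phi> = \<phi>" by (simp add: J_act_pairing)
next
  fix g h \<phi> assume "g \<in> carrier G" "h \<in> carrier G" "\<phi> \<in> J_lattice G \<H>"
  then show "J_act G \<H> (g \<otimes> h) \<phi> = J_act G \<H> g (J_act G \<H> h \<phi>)"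
    by (auto simp: J_lattice_eq J_act_pairing perm_sum_act_mult)
qed (auto simp: J_act_def dual_act_def fun_eq_iff)

text \<open>Since \<open>J\<close> is the permutation lattice modulo constants, a resolution of \<open>J\<close> may be given by
  a map on the permutation lattice whose kernel is the constants.\<close>

theorem quasi_permutation_J:
  fixes R :: "('a::countable \<Rightarrow> int) set" and F :: "('b::countable \<Rightarrow> int) set"
  assumes perm: "permutation_lattice G R actR" "permutation_lattice G F actF"
    and i: "G_hom G (perm_sum_lattice G \<H>) (perm_sum_act G \<H>) R actR \<iota>"
    and p: "G_hom G R actR F actF p" "p ` R = F"
    and const: "\<And>c. \<iota> (\<lambda>q. if q \<in> P then c else 0) = 0"
    and ker: "\<And>\<psi>. \<psi> \<in> perm_sum_lattice G \<H> \<Longrightarrow> \<iota> \<psi> = 0 \<Longrightarrow> \<exists>c. \<forall>q\<in>P. \<psi> q = c"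
    and ex: "\<iota> ` perm_sum_lattice G \<H> = {y \<in> R. p y = 0}"
  shows "quasi_permutation G (J_lattice G \<H>) (J_act G \<H>)"
proof -
  let ?W = "perm_sum_lattice G \<H>"
  \<comment> \<open>The map induced on the quotient. Since \<open>\<iota>\<close> kills constants,
    the choice of representative made by \<open>potential\<close> does not affect the value.\<close>
  define i where "i = \<iota> \<circ> potential"
  have add: "\<iota> (x + y) = \<iota> x + \<iota> y" if "x \<in> ?W" "y \<in> ?W" for x y
    using assms(3) that by (simp add: G_hom_def)
  have i_pairing: "i (pairing \<psi>) = \<iota> \<psi>" if "\<psi> \<in> ?W" for \<psi>
  proof -
    have "\<iota> \<psi> = \<iota> (potential (pairing \<psi>) + (\<lambda>q. if q \<in> P then \<psi> base else 0))"
      using that by (intro arg_cong[where f = \<iota>]) (auto simp: potential_pairing fun_eq_iff perm_sum_lattice_def)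
    also have "\<dots> = \<iota> (potential (pairing \<psi>)) + \<iota> (\<lambda>q. if q \<in> P then \<psi> base else 0)"
      by (rule add) (simp_all add: perm_sum_lattice_def potential_def)
    finally show ?thesis by (simp add: const i_def)
  qed
  have J: "J_lattice G \<H> = pairing ` ?W"
    using pairing_potential[symmetric] potential_mem pairing_mem by blast
  have Wadd: "x + y \<in> ?W" if "x \<in> ?W" "y \<in> ?W" for x y
    using that by (simp add: perm_sum_lattice_def)
  have pairing_add: "pairing x + pairing y = pairing (x + y)" for x y
    by (auto simp: pairing_def fun_eq_iff sum.distrib algebra_simps)
  have "G_hom G (J_lattice G \<H>) (J_act G \<H>) R actR i"
    using assms(3) unfolding G_hom_def J
    by (auto simp: i_pairing pairing_add Wadd J_act_pairing perm_sum_act_mem)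
  moreover have "inj_on i (J_lattice G \<H>)"
  proof (rule inj_onI)
    fix \<phi> \<phi>' assume *: "\<phi> \<in> J_lattice G \<H>" "\<phi>' \<in> J_lattice G \<H>" "i \<phi> = i \<phi>'"
    let ?d = "potential \<phi> - potential \<phi>'"
    have d: "?d \<in> ?W" using potential_mem[of \<phi>] potential_mem[of \<phi>'] by (simp add: perm_sum_lattice_def)
    have "\<iota> (?d + potential \<phi>') = \<iota> ?d + \<iota> (potential \<phi>')" by (rule add[OF d potential_mem])
    then have "\<iota> ?d = 0" using *(3) by (simp add: i_def)
    from ker[OF d this] obtain c where c: "\<And>q. q \<in> P \<Longrightarrow> ?d q = c" by blast
    \<comment> \<open>The two potentials differ by a constant, which pairs to 0 with every sum-zero
      function.\<close>
    have "\<And>q. q \<in> P \<Longrightarrow> potential \<phi> q = potential \<phi>' q + c" using c by fastforce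
    then have "pairing (potential \<phi>) f = pairing (potential \<phi>') f" for f
      by (auto simp: pairing_def algebra_simps sum.distrib I_lattice_def simp flip: sum_distrib_left)
    then show "\<phi> = \<phi>'" using pairing_potential *(1,2) by (metis ext)
  qed
  moreover have "i ` J_lattice G \<H> = {y \<in> R. p y = 0}"
    unfolding J ex[symmetric] image_image by (rule image_cong) (simp_all add: i_pairing)
  ultimately show ?thesis
    using quasi_permutation_countableI[OF G_lattice_J perm _ p(1) _ p(2)] by blast
qed

end

section \<open>Periodic sums\<close>

lemma periodic_dvd:
  fixes a :: "int \<Rightarrow> 'b"
  assumes per: "\<And>j. a (j + n) = a j" and "n dvd j - j'"
  shows "a j = a j'"
proof -
  obtain q where q: "j = j' + n * q" using assms(2) by (metis diff_add_cancel dvdE add.commute)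
  have "a (j' + n * q) = a j'"
  proof (induction q rule: int_induct[where k = 0])
    case (step1 i)
    then show ?case using per[of "j' + n * i"] by (simp add: algebra_simps)
  next
    case (step2 i)
    then show ?case using per[of "j' + n * (i - 1)"] by (simp add: algebra_simps)
  qed simp
  then show ?thesis by (simp add: q)
qed

text \<open>Take negated partial sums up to \<open>j mod n\<close>. At the wrap-around the partial
  sum restarts at 0, which is consistent because the sum over a full period vanishes.\<close>

lemma periodic_antiderivative:
  fixes c :: "int \<Rightarrow> int"
  assumes "n > 0" and per: "\<And>j. c (j + n) = c j" and sum: "(\<Sum>j\<in>{0..<n}. c j) = 0"
  shows "\<exists>\<beta>. (\<forall>j. \<beta> (j + n) = \<beta> j) \<and> (\<forall>j. \<beta> j - \<beta> (j + 1) = c j)"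
proof (intro exI conjI allI)
  let ?\<beta> = "\<lambda>j. - (\<Sum>i\<in>{0..<j mod n}. c i)"
  fix j
  show "?\<beta> (j + n) = ?\<beta> j" by simp
  define r where "r = j mod n"
  have r: "0 \<le> r" "r < n" using assms(1) by (simp_all add: r_def)
  have cr: "c j = c r" by (rule periodic_dvd[of c n]) (simp_all add: per r_def)
  have ins: "{0..<r + 1} = insert r {0..<r}" using r by auto
  then have step: "(\<Sum>i\<in>{0..<r + 1}. c i) = (\<Sum>i\<in>{0..<r}. c i) + c r" by simp
  have jr: "(j + 1) mod n = (r + 1) mod n" by (simp add: r_def mod_simps)
  show "?\<beta> j - ?\<beta> (j + 1) = c j"
  proof (cases "r + 1 = n")
    case True
    then show ?thesis using step sum cr jr by (simp flip: r_def)
  next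
    case False
    then have "(j + 1) mod n = r + 1" using r jr by simp
    then show ?thesis using step cr by (simp flip: r_def)
  qed
qed

text \<open>Moving the window by one step trades the value at \<open>0 + i\<close> for the equal
  value at \<open>n + i\<close>.\<close>

lemma sum_periodic_shift:
  fixes F :: "int \<Rightarrow> int"
  assumes per: "\<And>j. F (j + n) = F j"
  shows "(\<Sum>j\<in>{0..<n}. F (j + i)) = (\<Sum>j\<in>{0..<n}. F j)"
proof (cases "n > 0")
  case True
  have step: "(\<Sum>j\<in>{0..<n}. F (j + (i + 1))) = (\<Sum>j\<in>{0..<n}. F (j + i))" for i
  proof -
    have "(\<Sum>j\<in>{0..<n}. F (j + (i + 1))) = (\<Sum>j\<in>{1..<n + 1}. F (j + i))"
      by (rule sum.reindex_bij_witness[of _ "\<lambda>j. j - 1" "\<lambda>j. j + 1"]) (auto simp: algebra_simps)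
    also have "\<dots> = (\<Sum>j\<in>{1..<n}. F (j + i)) + F (n + i)"
    proof -
      have "{1..<n + 1} = insert n {1..<n}" using True by auto
      then show ?thesis by simp
    qed
    also have "F (n + i) = F (0 + i)" using per[of i] by (simp add: add.commute)
    also have "(\<Sum>j\<in>{1..<n}. F (j + i)) + F (0 + i) = (\<Sum>j\<in>{0..<n}. F (j + i))"
    proof -
      have "{0..<n} = insert 0 {1..<n}" using True by auto
      then show ?thesis by simp
    qed
    finally show ?thesis .
  qed
  show ?thesis
  proof (induction i rule: int_induct[where k = 0])
    case (step1 i)
    then show ?case using step[of i] by simp
  next
    case (step2 i)
    then show ?case using step[of "i - 1"] by simp
  qed simp
qed simp

lemma sum_periodic_neg:
  fixes F :: "int \<Rightarrow> int"
  assumes per: "\<And>j. F (j + n) = F j"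
  shows "(\<Sum>j\<in>{0..<n}. F (- j)) = (\<Sum>j\<in>{0..<n}. F j)"
proof -
  have "(\<Sum>j\<in>{0..<n}. F (- j)) = (\<Sum>j\<in>{0..<n}. F (j + 1 - n))"
    by (rule sum.reindex_bij_witness[of _ "\<lambda>j. n - 1 - j" "\<lambda>j. n - 1 - j"]) auto
  also have "\<dots> = (\<Sum>j\<in>{0..<n}. F j)"
    using sum_periodic_shift[of F n "1 - n"] per by (simp add: algebra_simps)
  finally show ?thesis .
qed

text \<open>The identity \<open>U (1 + S) = S^m - S\<close>, which becomes \<open>1 - S\<close> on
  \<open>m\<close>-periodic functions. The last sign is \<open>+1\<close> because
  \<open>m - 1\<close> is even.\<close>

lemma sum_alternating_telescope:
  fixes \<beta> :: "int \<Rightarrow> int"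
  assumes "odd m"
  shows "(\<Sum>i\<in>{1..<m}. (- 1) ^ i * (\<beta> (j + int i) + \<beta> (j + int i + 1))) = \<beta> (j + int m) - \<beta> (j + 1)"
proof -
  have "(\<Sum>i\<in>{1..<Suc n}. (- 1) ^ i * (\<beta> (j + int i) + \<beta> (j + int i + 1)))
      = (- 1) ^ n * \<beta> (j + int n + 1) - \<beta> (j + 1)" for n
    by (induction n) (auto simp: algebra_simps)
  moreover obtain n where "m = Suc n" using assms by (cases m) auto
  ultimately show ?thesis using assms by (simp add: algebra_simps)
qed

text \<open>The substitution of \<open>m - i\<close> for \<open>i\<close> flips the sign, as
  \<open>m\<close> is odd. Such reversed sums arise on elements involving \<open>t\<close>, where
  right multiplication by \<open>s^i\<close> lowers the exponent \<open>j\<close>.\<close>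

lemma sum_alternating_reflect:
  fixes \<omega> :: "int \<Rightarrow> int"
  assumes "odd m" and per: "\<And>j. \<omega> (j + int m) = \<omega> j"
  shows "(\<Sum>i\<in>{1..<m}. (- 1) ^ i * \<omega> (j - int i)) = - (\<Sum>i\<in>{1..<m}. (- 1) ^ i * \<omega> (j + int i))"
proof -
  have "(\<Sum>i\<in>{1..<m}. (- 1) ^ i * \<omega> (j - int i)) = (\<Sum>i\<in>{1..<m}. - ((- 1) ^ i * \<omega> (j + int i)))"
  proof (rule sum.reindex_bij_witness[of _ "\<lambda>i. m - i" "\<lambda>i. m - i"])
    fix i assume i: "i \<in> {1..<m}"
    have "\<omega> (j + int (m - i)) = \<omega> (j - int i)"
      using per[of "j - int i"] i by (simp add: of_nat_diff algebra_simps)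
    moreover have "(- 1 :: int) ^ (m - i) = - ((- 1) ^ i)"
      using assms(1) i by (cases "even i") auto
    ultimately show "- ((- 1) ^ (m - i) * \<omega> (j + int (m - i))) = (- 1) ^ i * \<omega> (j - int i)" by simp
  qed auto
  then show ?thesis by (simp add: sum_negf)
qed

text \<open>For odd \<open>i\<close> the number \<open>m - i\<close> is even, so odd shifts in both
  directions together reach every nonzero residue modulo \<open>m\<close> exactly once.\<close>

lemma sum_odd_symmetric:
  fixes F :: "int \<Rightarrow> int"
  assumes "odd m" and per: "\<And>j. F (j + int m) = F j"
  shows "F j + (\<Sum>i\<in>{1..<m}. of_bool (odd i) * (F (j + int i) + F (j - int i)))
    = (\<Sum>i\<in>{0..<int m}. F (j + i))"
proof -
  have "(\<Sum>i\<in>{1..<m}. of_bool (odd i) * F (j - int i)) = (\<Sum>i\<in>{1..<m}. of_bool (even i) * F (j + int i))"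
  proof (rule sum.reindex_bij_witness[of _ "\<lambda>i. m - i" "\<lambda>i. m - i"])
    fix i assume i: "i \<in> {1..<m}"
    have "F (j + int (m - i)) = F (j - int i)"
      using per[of "j - int i"] i by (simp add: of_nat_diff algebra_simps)
    moreover have "even (m - i) \<longleftrightarrow> odd i" using assms(1) i by auto
    ultimately show "of_bool (even (m - i)) * F (j + int (m - i)) = of_bool (odd i) * F (j - int i)" by simp
  qed auto
  then have "(\<Sum>i\<in>{1..<m}. of_bool (odd i) * (F (j + int i) + F (j - int i)))
      = (\<Sum>i\<in>{1..<m}. of_bool (odd i) * F (j + int i) + of_bool (even i) * F (j + int i))"
    by (simp add: algebra_simps sum.distrib)
  also have "\<dots> = (\<Sum>i\<in>{1..<m}. F (j + int i))" by (rule sum.cong) auto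
  also have "F j + \<dots> = (\<Sum>i\<in>{0..<m}. F (j + int i))"
    using assms(1) by (simp add: sum.atLeast_Suc_lessThan odd_pos)
  also have "\<dots> = (\<Sum>i\<in>{0..<int m}. F (j + i))"
    by (rule sum.reindex_bij_witness[of _ nat int]) auto
  finally show ?thesis by simp
qed

section \<open>Coordinates on the dihedral group\<close>

lemma (in group) generate_involution:
  assumes "x \<in> carrier G" "x \<otimes> x = \<one>"
  shows "generate G {x} = {\<one>, x}"
proof
  have "subgroup {\<one>, x} G"
  proof (rule subgroupI)
    fix a assume "a \<in> {\<one>, x}"
    moreover have "inv x = x" using assms inv_equality by blast
    ultimately show "inv a \<in> {\<one>, x}" by auto
  qed (use assms in auto)
  then show "generate G {x} \<subseteq> {\<one>, x}" by (rule generate_subgroup_incl[rotated]) simp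
  show "{\<one>, x} \<subseteq> generate G {x}" by (auto intro: generate.intros)
qed

lemma (in group) subgroup_involution:
  assumes "x \<in> carrier G" "x \<otimes> x = \<one>"
  shows "subgroup {\<one>, x} G"
  using generate_is_subgroup[of "{x}"] assms by (simp add: generate_involution)

locale odd_dihedral =
  fixes m :: nat
  assumes odd_m: "odd m"
begin

abbreviation G where "G \<equiv> dihedral (2 * m)"

text \<open>\<open>el j e k\<close> is \<open>s\<^sup>j t\<^sup>e z\<^sup>k\<close> with \<open>s = \<sigma>\<^bsup>m+1\<^esup>\<close>, \<open>t = \<tau>\<close>, \<open>z = \<sigma>\<^sup>m\<close>.\<close>

definition el :: "int \<Rightarrow> bool \<Rightarrow> bool \<Rightarrow> int \<times> int" where
  "el j e k = ((j * (int m + 1) + (if k then int m else 0)) mod (2 * int m), of_bool e)"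

lemma m_pos: "m > 0" using odd_m by (rule odd_pos)

lemma el_mult: "el j e k \<otimes>\<^bsub>G\<^esub> el j' e' k' = el (if e then j - j' else j + j') (e \<noteq> e') (k \<noteq> k')"
proof -
  define M where "M = 2 * int m"
  define v where "v j k = j * (int m + 1) + (if k then int m else 0)" for j k
  have el: "el j e k = (v j k mod M, of_bool e)" for j e k by (simp add: el_def v_def M_def)
  have M: "2 * int m = M" by (simp add: M_def)
  have "(v j k + v j' k') mod M = v (j + j') (k \<noteq> k') mod M"
  \<comment> \<open>Two factors \<open>z\<close> contribute \<open>2 * m\<close> to the exponent,
    which is \<open>M\<close> and vanishes modulo \<open>M\<close>. The difference below has the
    same carry when only \<open>k'\<close> holds.\<close>
  proof (cases "k \<and> k'")
    case True
    then have "v j k + v j' k' = v (j + j') (k \<noteq> k') + M" by (simp add: v_def M_def algebra_simps)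
    then show ?thesis by simp
  qed (auto simp: v_def algebra_simps)
  moreover have "(v j k - v j' k') mod M = v (j - j') (k \<noteq> k') mod M"
  proof (cases "k' \<and> \<not> k")
    case True
    then have "v (j - j') (k \<noteq> k') = v j k - v j' k' + M" by (simp add: v_def M_def algebra_simps)
    then show ?thesis by simp
  qed (auto simp: v_def algebra_simps)
  ultimately show ?thesis
    by (cases e; cases e') (simp_all add: el dihedral_def M mod_simps)
qed

lemma el_mult_0: "el j e k \<otimes>\<^bsub>G\<^esub> el 0 e' k' = el j (e \<noteq> e') (k \<noteq> k')"
  by (cases e) (simp_all add: el_mult)

lemma el_one: "\<one>\<^bsub>G\<^esub> = el 0 False False"
  by (simp add: el_def dihedral_def)

text \<open>Chinese remainder theorem for the exponent of sigma modulo \<open>2 * m\<close>: since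
  \<open>m + 1\<close> is even and congruent to 1 modulo the odd number \<open>m\<close>, the parity
  determines \<open>k\<close> and the residue modulo \<open>m\<close> is that of
  \<open>j\<close>.\<close>

lemma el_eq_iff: "el j e k = el j' e' k' \<longleftrightarrow> int m dvd j - j' \<and> e = e' \<and> k = k'"
proof -
  let ?v = "\<lambda>j k. j * (int m + 1) + (if k then int m else 0)"
  have cop: "coprime 2 (int m)" using odd_m by simp
  have ev: "even (int m + 1)" using odd_m by simp
  have "?v j k mod (2 * int m) = ?v j' k' mod (2 * int m) \<longleftrightarrow> 2 * int m dvd ?v j k - ?v j' k'"
    by (rule mod_eq_dvd_iff)
  also have "\<dots> \<longleftrightarrow> 2 dvd ?v j k - ?v j' k' \<and> int m dvd ?v j k - ?v j' k'"
    using cop by (meson divides_mult dvd_mult_left dvd_mult_right)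
  also have "2 dvd ?v j k - ?v j' k' \<longleftrightarrow> k = k'"
    using ev odd_m by auto
  also have "int m dvd ?v j k - ?v j' k' \<longleftrightarrow> int m dvd j - j'"
  proof -
    have "?v j k - ?v j' k' = (j - j') + int m * ((j - j') + of_bool k - of_bool k')"
      by (simp add: algebra_simps)
    then show ?thesis by (simp add: dvd_add_left_iff)
  qed
  finally show ?thesis by (auto simp: el_def)
qed

lemma el_period: "el (j + int m) e k = el j e k" by (simp add: el_eq_iff)

lemma inj_el: "inj_on (\<lambda>(j, e, k). el j e k) ({0..<int m} \<times> UNIV \<times> UNIV)"
proof -
  have "j = j'" if "j \<in> {0..<int m}" "j' \<in> {0..<int m}" "int m dvd j - j'" for j j'
  proof -
    have "j mod int m = j' mod int m" using that(3) by (simp add: mod_eq_dvd_iff)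
    then show ?thesis using that(1,2) by simp
  qed
  then show ?thesis by (fastforce simp: inj_on_def el_eq_iff)
qed

text \<open>By counting: the coordinate map is injective on \<open>4 * m\<close> triples, and the
  group has \<open>4 * m\<close> elements.\<close>

lemma carrier_eq: "carrier G = (\<lambda>(j, e, k). el j e k) ` ({0..<int m} \<times> UNIV \<times> UNIV)"
proof -
  let ?f = "\<lambda>(j, e, k). el j e k" and ?D = "{0..<int m} \<times> (UNIV :: bool set) \<times> (UNIV :: bool set)"
  have sub: "?f ` ?D \<subseteq> carrier G" using m_pos by (auto simp: el_def dihedral_def)
  have "card (?f ` ?D) = card (carrier G)"
    unfolding card_image[OF inj_el]
    by (simp add: dihedral_def card_cartesian_product nat_mult_distrib del: UNIV_Times_UNIV)
  moreover have "finite (carrier G)" by (simp add: dihedral_def)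
  ultimately show ?thesis using card_subset_eq[OF _ sub] by metis
qed

lemma el_carrier [simp]: "el j e k \<in> carrier G"
  using m_pos by (simp add: el_def dihedral_def)

lemma carrierE:
  assumes "x \<in> carrier G"
  obtains j e k where "x = el j e k"
  using assms unfolding carrier_eq by auto

lemma finite_carrier_dihedral: "finite (carrier G)" by (simp add: dihedral_def)

lemma sum_carrier:
  fixes F :: "int \<times> int \<Rightarrow> int"
  shows "(\<Sum>x\<in>carrier G. F x) = (\<Sum>j\<in>{0..<int m}. F (el j False False) + F (el j False True)
      + F (el j True False) + F (el j True True))"
proof -
  have "(\<Sum>x\<in>carrier G. F x) = (\<Sum>(j, e, k)\<in>{0..<int m} \<times> UNIV \<times> UNIV. F (el j e k))"
    unfolding carrier_eq by (subst sum.reindex[OF inj_el]) (simp add: case_prod_unfold)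
  also have "\<dots> = (\<Sum>j\<in>{0..<int m}. \<Sum>e\<in>UNIV. \<Sum>k\<in>UNIV. F (el j e k))"
    by (simp add: sum.cartesian_product)
  finally show ?thesis by (simp add: UNIV_bool algebra_simps)
qed

lemma group_dihedral: "group G"
proof (rule groupI)
  fix x y assume "x \<in> carrier G" "y \<in> carrier G"
  then show "x \<otimes>\<^bsub>G\<^esub> y \<in> carrier G" by (auto elim!: carrierE simp: el_mult)
next
  fix x y z assume "x \<in> carrier G" "y \<in> carrier G" "z \<in> carrier G"
  then show "x \<otimes>\<^bsub>G\<^esub> y \<otimes>\<^bsub>G\<^esub> z = x \<otimes>\<^bsub>G\<^esub> (y \<otimes>\<^bsub>G\<^esub> z)"
    by (elim carrierE) (simp add: el_mult; auto simp: el_eq_iff)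
next
  fix x assume "x \<in> carrier G"
  then obtain j e k where x: "x = el j e k" by (rule carrierE)
  have "el (if e then j else - j) e k \<otimes>\<^bsub>G\<^esub> x = \<one>\<^bsub>G\<^esub>" by (simp add: x el_mult el_one)
  then show "\<exists>y\<in>carrier G. y \<otimes>\<^bsub>G\<^esub> x = \<one>\<^bsub>G\<^esub>" by (meson el_carrier)
qed (auto elim!: carrierE simp: el_one el_mult)

end

sublocale odd_dihedral \<subseteq> group "dihedral (2 * m)" by (rule group_dihedral)

context odd_dihedral
begin

text \<open>Sigma equals \<open>s z\<close>, because \<open>(m + 1) + m\<close> is 1 modulo
  \<open>2 * m\<close>. For exponent \<open>m\<close> this leaves \<open>z\<close>, as
  \<open>s\<close> has order \<open>m\<close> and \<open>m\<close> is odd.\<close>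

lemma sigma_pow: "dih_sigma (2 * m) [^]\<^bsub>G\<^esub> n = el (int n) False (odd n)" for n :: nat
proof (induction n)
  case (Suc n)
  have "dih_sigma (2 * m) = el 1 False True"
    using mod_add_self1[of "2 * int m" 1] by (simp add: dih_sigma_def el_def algebra_simps)
  then show ?case using Suc by (simp add: el_mult add.commute)
qed (simp add: el_one)

abbreviation "HZ \<equiv> {el 0 False False, el 0 False True}"
abbreviation "HT \<equiv> {el 0 False False, el 0 True False}"

lemma generate_sigma_pow: "generate G {dih_sigma (2 * m) [^]\<^bsub>G\<^esub> m} = HZ"
proof -
  have "dih_sigma (2 * m) [^]\<^bsub>G\<^esub> m = el 0 False True" using odd_m by (simp add: sigma_pow el_eq_iff)
  then show ?thesis using generate_involution[of "el 0 False True"] by (simp add: el_mult el_one)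
qed

lemma generate_tau: "generate G {dih_tau (2 * m)} = HT"
proof -
  have "dih_tau (2 * m) = el 0 True False" by (simp add: dih_tau_def el_def)
  then show ?thesis using generate_involution[of "el 0 True False"] by (simp add: el_mult el_one)
qed

abbreviation "HTZ \<equiv> {el 0 False False, el 0 True True}"
abbreviation "HS \<equiv> range (\<lambda>(j, k). el j False k)"

lemma subgroup_HZ: "subgroup HZ G" and subgroup_HT: "subgroup HT G" and subgroup_HTZ: "subgroup HTZ G"
  using subgroup_involution[of "el 0 False True"] subgroup_involution[of "el 0 True False"]
    subgroup_involution[of "el 0 True True"]
  by (simp_all add: el_mult el_one)

lemma inv_el: "inv\<^bsub>G\<^esub> (el j e k) = el (if e then j else - j) e k"
  by (rule inv_equality) (simp_all add: el_mult el_one)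

lemma subgroup_HS: "subgroup HS G"
proof (rule subgroupI)
  fix a b assume "a \<in> HS" "b \<in> HS"
  then obtain j k j' k' where "a = el j False k" "b = el j' False k'" by auto
  then have "a \<otimes>\<^bsub>G\<^esub> b = (\<lambda>(j, k). el j False k) (j + j', k \<noteq> k')" by (simp add: el_mult)
  then show "a \<otimes>\<^bsub>G\<^esub> b \<in> HS" by blast
next
  fix a assume "a \<in> HS"
  then obtain j k where "a = el j False k" by auto
  then have "inv\<^bsub>G\<^esub> a = (\<lambda>(j, k). el j False k) (- j, k)" by (simp add: inv_el)
  then show "inv\<^bsub>G\<^esub> a \<in> HS" by blast
qed auto

section \<open>The permutation lattices \<open>R\<close> and \<open>F\<close> in coordinates\<close>

definition "HR n = (if n = 0 then {\<one>\<^bsub>G\<^esub>} else if n = Suc 0 then HZ else carrier G)"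
definition "HF n = (if n = 0 then HTZ else HS)" for n :: nat

abbreviation "R \<equiv> coset_fun_lattice G {0, 1, 2 :: nat} HR"
abbreviation "F \<equiv> coset_fun_lattice G {0, 1 :: nat} HF"

lemma permutation_lattice_R: "permutation_lattice G R (translate G)"
  by (rule permutation_lattice_coset_fun)
    (auto simp: HR_def finite_carrier_dihedral subgroup_HZ triv_subgroup subgroup_self)

lemma permutation_lattice_F: "permutation_lattice G F (translate G)"
  by (rule permutation_lattice_coset_fun)
    (auto simp: HF_def finite_carrier_dihedral subgroup_HTZ subgroup_HS)

lemma R_iff: "f \<in> R \<longleftrightarrow> (\<forall>n x. n \<notin> {0, 1, 2} \<or> x \<notin> carrier G \<longrightarrow> f (n, x) = 0)
    \<and> (\<forall>j e. f (1, el j e True) = f (1, el j e False))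
    \<and> (\<forall>x\<in>carrier G. f (2, x) = f (2, \<one>\<^bsub>G\<^esub>))" (is "_ \<longleftrightarrow> ?S \<and> ?B \<and> ?N")
proof
  assume f: "f \<in> R"
  then have H: "f (n, x \<otimes>\<^bsub>G\<^esub> h) = f (n, x)" if "n \<in> {0, 1, 2}" "x \<in> carrier G" "h \<in> HR n" for n x h
    using that unfolding coset_fun_lattice_def by blast
  have ?S using f unfolding coset_fun_lattice_def by blast
  moreover have ?B
    using H[of 1 "el j e False" "el 0 False True" for j e] by (simp add: HR_def el_mult_0)
  moreover have ?N
  proof
    fix x assume "x \<in> carrier G"
    then show "f (2, x) = f (2, \<one>\<^bsub>G\<^esub>)" using H[of 2 "\<one>\<^bsub>G\<^esub>" x] by (simp add: HR_def)
  qed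
  ultimately show "?S \<and> ?B \<and> ?N" by blast
next
  assume *: "?S \<and> ?B \<and> ?N"
  have "f (n, x \<otimes>\<^bsub>G\<^esub> h) = f (n, x)" if n: "n \<in> {0, 1, 2}" "x \<in> carrier G" "h \<in> HR n" for n x h
  proof -
    obtain j e k where x: "x = el j e k" using n(2) by (rule carrierE)
    consider "n = 0" | "n = 1" | "n = 2" using n(1) by blast
    then show ?thesis
    proof cases
      case 1
      then show ?thesis using n by (simp add: HR_def)
    next
      case 2
      have "f (1, el j e True) = f (1, el j e False)" using * by blast
      then show ?thesis using n 2 by (cases k) (auto simp: HR_def x el_mult_0)
    next
      case 3
      then have "h \<in> carrier G" using n(3) by (simp add: HR_def)
      then show ?thesis using 3 n(2) * m_closed by metis
    qed
  qed
  then show "f \<in> R" using * unfolding coset_fun_lattice_def by blast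
qed

text \<open>The coset of \<open>HTZ\<close> is met by flipping \<open>e\<close> and \<open>k\<close>
  together, while a coset of the rotation group \<open>HS\<close> remembers only
  \<open>e\<close>.\<close>

lemma F_iff: "f \<in> F \<longleftrightarrow> (\<forall>n x. n \<notin> {0, 1} \<or> x \<notin> carrier G \<longrightarrow> f (n, x) = 0)
    \<and> (\<forall>j e k. f (0, el j (\<not> e) (\<not> k)) = f (0, el j e k))
    \<and> (\<forall>j e k. f (1, el j e k) = f (1, el 0 e False))" (is "_ \<longleftrightarrow> ?S \<and> ?A \<and> ?C")
proof
  assume f: "f \<in> F"
  then have H: "f (n, x \<otimes>\<^bsub>G\<^esub> h) = f (n, x)" if "n \<in> {0, 1}" "x \<in> carrier G" "h \<in> HF n" for n x h
    using that unfolding coset_fun_lattice_def by blast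
  have ?S using f unfolding coset_fun_lattice_def by blast
  moreover have ?A
    using H[of 0 "el j e k" "el 0 True True" for j e k] by (simp add: HF_def el_mult_0)
  moreover have ?C
  proof (intro allI)
    fix j e k
    \<comment> \<open>The sign compensates for \<open>t\<close> inverting \<open>s\<close>, so that
      \<open>el 0 e False\<close> times this rotation has first coordinate \<open>j\<close>.\<close>
    have "el (if e then - j else j) False k \<in> HF 1" by (auto simp: HF_def)
    from H[OF _ _ this, of "el 0 e False"] show "f (1, el j e k) = f (1, el 0 e False)"
      by (cases e) (simp_all add: el_mult)
  qed
  ultimately show "?S \<and> ?A \<and> ?C" by blast
next
  assume *: "?S \<and> ?A \<and> ?C"
  have "f (n, x \<otimes>\<^bsub>G\<^esub> h) = f (n, x)" if n: "n \<in> {0, 1}" "x \<in> carrier G" "h \<in> HF n" for n x h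
  proof -
    obtain j e k where x: "x = el j e k" using n(2) by (rule carrierE)
    consider "n = 0" | "n = 1" using n(1) by blast
    then show ?thesis
    proof cases
      case 1
      then show ?thesis using n * by (auto simp: HF_def x el_mult_0)
    next
      case 2
      then obtain j' k' where h: "h = el j' False k'" using n(3) by (auto simp: HF_def)
      have "x \<otimes>\<^bsub>G\<^esub> h = el (if e then j - j' else j + j') e (k \<noteq> k')" by (simp add: x h el_mult)
      then show ?thesis unfolding 2 x using * by metis
    qed
  qed
  then show "f \<in> F" using * unfolding coset_fun_lattice_def by blast
qed

lemma coset_HZ: "el j e k <#\<^bsub>G\<^esub> HZ = {el j e False, el j e True}"
  by (cases k) (auto simp: l_coset_def el_mult_0)

lemma coset_HT: "el j e k <#\<^bsub>G\<^esub> HT = {el j False k, el j True k}"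
  by (cases e) (auto simp: l_coset_def el_mult_0)

lemma HZ_neq_HT: "HZ \<noteq> HT"
proof -
  have "el 0 False True \<notin> HT" by (simp add: el_eq_iff)
  then show ?thesis by blast
qed

end

sublocale odd_dihedral \<subseteq> coset_family "dihedral (2 * m)"
    "{{el 0 False False, el 0 False True}, {el 0 False False, el 0 True False}}"
proof (intro coset_family.intro coset_family_axioms.intro)
  show "group (dihedral (2 * m))" by (rule group_dihedral)
  show "finite (carrier (dihedral (2 * m)))" by (rule finite_carrier_dihedral)
  show "subgroup H (dihedral (2 * m))" if "H \<in> {HZ, HT}" for H
    using that subgroup_HZ subgroup_HT by blast
qed simp

context odd_dihedral
begin

section \<open>The pair \<open>X\<close>, \<open>Y\<close> attached to an element of the permutation
  lattice\<close>

abbreviation "W \<equiv> perm_sum_lattice G {HZ, HT}"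
abbreviation "actW \<equiv> perm_sum_act G {HZ, HT}"

definition X where "X \<psi> x = \<psi> (HZ, x <#\<^bsub>G\<^esub> HZ)" for \<psi> :: "_ \<Rightarrow> int"
definition Y where "Y \<psi> x = \<psi> (HT, x <#\<^bsub>G\<^esub> HT)" for \<psi> :: "_ \<Rightarrow> int"

lemma X_el: "X \<psi> (el j e k) = X \<psi> (el j e False)" by (simp add: X_def coset_HZ)
lemma Y_el: "Y \<psi> (el j e k) = Y \<psi> (el j False k)" by (simp add: Y_def coset_HT)

lemma X_add: "X (\<psi> + \<psi>') x = X \<psi> x + X \<psi>' x" and Y_add: "Y (\<psi> + \<psi>') x = Y \<psi> x + Y \<psi>' x"
  by (simp_all add: X_def Y_def)

lemma P_cases:
  assumes "q \<in> P"
  obtains x where "x \<in> carrier G" "\<And>\<psi>. \<psi> q = X \<psi> x" | x where "x \<in> carrier G" "\<And>\<psi>. \<psi> q = Y \<psi> x"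
  using assms by (auto simp: coset_index_def X_def Y_def)

lemma P_mem: "x \<in> carrier G \<Longrightarrow> (HZ, x <#\<^bsub>G\<^esub> HZ) \<in> P" "x \<in> carrier G \<Longrightarrow> (HT, x <#\<^bsub>G\<^esub> HT) \<in> P"
  by (auto simp: coset_index_def)

lemma X_act:
  assumes "g \<in> carrier G" "x \<in> carrier G"
  shows "X (actW g \<psi>) x = X \<psi> (inv\<^bsub>G\<^esub> g \<otimes>\<^bsub>G\<^esub> x)"
proof -
  have "inv\<^bsub>G\<^esub> g <#\<^bsub>G\<^esub> (x <#\<^bsub>G\<^esub> HZ) = (inv\<^bsub>G\<^esub> g \<otimes>\<^bsub>G\<^esub> x) <#\<^bsub>G\<^esub> HZ"
    by (rule lcos_m_assoc) (use assms in auto)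
  then show ?thesis using P_mem(1)[OF assms(2)] by (simp add: X_def perm_sum_act_def)
qed

lemma Y_act:
  assumes "g \<in> carrier G" "x \<in> carrier G"
  shows "Y (actW g \<psi>) x = Y \<psi> (inv\<^bsub>G\<^esub> g \<otimes>\<^bsub>G\<^esub> x)"
proof -
  have "inv\<^bsub>G\<^esub> g <#\<^bsub>G\<^esub> (x <#\<^bsub>G\<^esub> HT) = (inv\<^bsub>G\<^esub> g \<otimes>\<^bsub>G\<^esub> x) <#\<^bsub>G\<^esub> HT"
    by (rule lcos_m_assoc) (use assms in auto)
  then show ?thesis using P_mem(2)[OF assms(2)] by (simp add: Y_def perm_sum_act_def)
qed

text \<open>Coordinates are unique except for \<open>j\<close> modulo \<open>m\<close>, so
  periodicity makes the choice of a triple harmless.\<close>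

lemma ex_fun_el:
  fixes a :: "int \<Rightarrow> bool \<Rightarrow> bool \<Rightarrow> int"
  assumes per: "\<And>j. a (j + int m) = a j"
  shows "\<exists>f. \<forall>j e k. f (el j e k) = a j e k"
proof
  let ?f = "\<lambda>x. case (SOME (j, e, k). x = el j e k) of (j, e, k) \<Rightarrow> a j e k"
  show "\<forall>j e k. ?f (el j e k) = a j e k"
  proof (intro allI)
    fix j e k
    let ?t = "SOME (j', e', k'). el j e k = el j' e' k'"
    have "case ?t of (j', e', k') \<Rightarrow> el j e k = el j' e' k'"
      by (rule someI[of _ "(j, e, k)"]) simp
    then obtain j' e' k' where t: "?t = (j', e', k')" "el j e k = el j' e' k'" by (cases ?t) simp
    then have "int m dvd j - j'" "e = e'" "k = k'" by (auto simp: el_eq_iff)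
    then show "?f (el j e k) = a j e k" using t(1) periodic_dvd[of a "int m" j j'] per by simp
  qed
qed

text \<open>The coset of \<open>HZ\<close> remembers \<open>j\<close> and \<open>e\<close>, that of
  \<open>HT\<close> remembers \<open>j\<close> and \<open>k\<close>; periodicity in \<open>j\<close>
  is the only constraint, so \<open>X\<close> and \<open>Y\<close> can be prescribed
  independently.\<close>

lemma ex_W:
  fixes xs ys :: "int \<Rightarrow> bool \<Rightarrow> int"
  assumes "\<And>j. xs (j + int m) = xs j" "\<And>j. ys (j + int m) = ys j"
  shows "\<exists>\<psi>\<in>W. (\<forall>j e k. X \<psi> (el j e k) = xs j e) \<and> (\<forall>j e k. Y \<psi> (el j e k) = ys j k)"
proof -
  obtain fx where fx: "\<And>j e k. fx (el j e k) = xs j e"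
    using ex_fun_el[of "\<lambda>j e k. xs j e"] assms(1) by auto
  obtain fy where fy: "\<And>j e k. fy (el j e k) = ys j k"
    using ex_fun_el[of "\<lambda>j e k. ys j k"] assms(2) by auto
  define \<psi> where "\<psi> = (\<lambda>(H, C). if (H, C) \<in> P then if H = HZ then fx (SOME x. x \<in> C) else fy (SOME x. x \<in> C) else 0)"
  have some: "(SOME x. x \<in> {a, b}) \<in> {a, b}" for a b :: "int \<times> int"
    by (rule someI[of _ a]) simp
  have "\<psi> \<in> W" by (auto simp: \<psi>_def perm_sum_lattice_def)
  moreover have "X \<psi> (el j e k) = xs j e" for j e k
    using P_mem(1)[of "el j e k"] some[of "el j e False" "el j e True"] fx
    by (auto simp: X_def \<psi>_def coset_HZ)
  moreover have "Y \<psi> (el j e k) = ys j k" for j e k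
    using P_mem(2)[of "el j e k"] some[of "el j False k" "el j True k"] fy HZ_neq_HT
    by (auto simp: Y_def \<psi>_def coset_HT)
  ultimately show ?thesis by blast
qed

section \<open>The two maps\<close>

text \<open>The \<open>div 2\<close> is exact, by \<open>sum_X_minus_Y\<close>: every value of
  \<open>X\<close> and of \<open>Y\<close> is taken on a coset of two elements. The summand
  \<open>Z\<close> of \<open>R\<close> appears as constant functions on the group, at index
  2.\<close>

definition iota :: "((int \<times> int) set \<times> (int \<times> int) set \<Rightarrow> int) \<Rightarrow> nat \<times> (int \<times> int) \<Rightarrow> int" where
  "iota \<psi> = (\<lambda>(n, x). if x \<notin> carrier G then 0
     else if n = 0 then X \<psi> x - Y \<psi> x
     else if n = 1 then \<Sum>i\<in>{1..<m}. (- 1) ^ i * X \<psi> (x \<otimes>\<^bsub>G\<^esub> el (int i) False False)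
     else if n = 2 then (\<Sum>y\<in>carrier G. X \<psi> y - Y \<psi> y) div 2
     else 0)"

text \<open>The four right factors are \<open>v s^i\<close> for \<open>v\<close> in the Klein
  four-group generated by \<open>t\<close> and \<open>z\<close>; the exponent \<open>- int i\<close>
  comes from \<open>t s^i = s^(-i) t\<close>.\<close>

definition proj :: "int \<Rightarrow> (nat \<times> (int \<times> int) \<Rightarrow> int) \<Rightarrow> nat \<times> (int \<times> int) \<Rightarrow> int" where
  "proj l f = (\<lambda>(n, x). if x \<notin> carrier G then 0
     else if n = 0 then f (0, x) + f (0, x \<otimes>\<^bsub>G\<^esub> el 0 True True)
       + (\<Sum>i\<in>{1..<m}. of_bool (odd i) *
           (f (0, x \<otimes>\<^bsub>G\<^esub> el (int i) False False) + f (0, x \<otimes>\<^bsub>G\<^esub> el (int i) False True)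
          + f (0, x \<otimes>\<^bsub>G\<^esub> el (- int i) True False) + f (0, x \<otimes>\<^bsub>G\<^esub> el (- int i) True True)))
       + f (1, x) + f (1, x \<otimes>\<^bsub>G\<^esub> el 0 True False) - f (2, x)
     else if n = 1 then l * (\<Sum>y\<in>carrier G. f (0, y))
       + (\<Sum>j\<in>{0..<int m}. f (1, x \<otimes>\<^bsub>G\<^esub> el j False False)) - 2 * l * f (2, x)
     else 0)"

lemma sum_X_minus_Y:
  "(\<Sum>y\<in>carrier G. X \<psi> y - Y \<psi> y) = 2 * (\<Sum>j\<in>{0..<int m}. X \<psi> (el j False False) + X \<psi> (el j True False)
     - Y \<psi> (el j False False) - Y \<psi> (el j False True))"
proof -
  have x: "X \<psi> (el j e True) = X \<psi> (el j e False)" and y: "Y \<psi> (el j True k) = Y \<psi> (el j False k)" for j e k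
    using X_el Y_el by auto
  show ?thesis unfolding sum_carrier sum_distrib_left by (rule sum.cong) (simp_all add: x y)
qed

lemma iota_0: "iota \<psi> (0, el j e k) = X \<psi> (el j e False) - Y \<psi> (el j False k)"
  using X_el[of \<psi> j e k] Y_el[of \<psi> j e k] by (simp add: iota_def)

lemma iota_1: "iota \<psi> (1, el j e k) =
    (\<Sum>i\<in>{1..<m}. (- 1) ^ i * X \<psi> (el (if e then j - int i else j + int i) e False))"
  by (simp add: iota_def el_mult X_el[where k = k])

lemma iota_2: "x \<in> carrier G \<Longrightarrow> iota \<psi> (2, x) =
    (\<Sum>j\<in>{0..<int m}. X \<psi> (el j False False) + X \<psi> (el j True False) - Y \<psi> (el j False False) - Y \<psi> (el j False True))"
  by (simp add: iota_def sum_X_minus_Y)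

lemma iota_off: "n \<notin> {0, 1, 2} \<or> x \<notin> carrier G \<Longrightarrow> iota \<psi> (n, x) = 0"
  by (auto simp: iota_def)

lemma iota_mem: "iota \<psi> \<in> R"
  unfolding R_iff
proof (intro conjI allI impI ballI)
  fix n :: nat and x assume "n \<notin> {0, 1, 2} \<or> x \<notin> carrier G"
  then show "iota \<psi> (n, x) = 0" by (rule iota_off)
next
  fix x assume "x \<in> carrier G"
  then show "iota \<psi> (2, x) = iota \<psi> (2, \<one>\<^bsub>G\<^esub>)" by (simp only: iota_2 one_closed)
qed (simp only: iota_1)

lemma iota_add: "iota (\<psi> + \<psi>') = iota \<psi> + iota \<psi>'"
proof
  fix q :: "nat \<times> int \<times> int"
  obtain n x where q: "q = (n, x)" by (cases q)
  consider "n \<notin> {0, 1, 2} \<or> x \<notin> carrier G" | "n = 0" "x \<in> carrier G" | "n = 1" "x \<in> carrier G"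
    | "n = 2" "x \<in> carrier G" by blast
  then show "iota (\<psi> + \<psi>') q = (iota \<psi> + iota \<psi>') q"
  proof cases
    case 1
    then show ?thesis using iota_off[of n x] by (simp add: q)
  next
    case 4
    \<comment> \<open>Division is not additive in general, so the explicit half from
      \<open>iota_2\<close> is used.\<close>
    have "iota (\<psi> + \<psi>') (2, x) = iota \<psi> (2, x) + iota \<psi>' (2, x)"
      unfolding iota_2[OF 4(2)] sum.distrib[symmetric] X_add Y_add by (simp add: algebra_simps)
    then show ?thesis by (simp add: q 4(1))
  qed (simp_all add: q iota_def X_add Y_add algebra_simps sum.distrib)
qed

lemma sum_left_mult:
  fixes f :: "int \<times> int \<Rightarrow> int"
  assumes "g \<in> carrier G"
  shows "(\<Sum>y\<in>carrier G. f (g \<otimes>\<^bsub>G\<^esub> y)) = (\<Sum>y\<in>carrier G. f y)"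
  by (rule sum.reindex_bij_witness[of _ "\<lambda>y. inv\<^bsub>G\<^esub> g \<otimes>\<^bsub>G\<^esub> y" "\<lambda>y. g \<otimes>\<^bsub>G\<^esub> y"])
    (use assms in \<open>auto simp flip: m_assoc\<close>)

text \<open>The components are built from right multiplications and sums over the whole group; the
  former commute with left translation and the latter are invariant under it.\<close>

lemma iota_equivariant:
  assumes "g \<in> carrier G"
  shows "iota (actW g \<psi>) = translate G g (iota \<psi>)"
proof -
  have "(\<Sum>y\<in>carrier G. X (actW g \<psi>) y - Y (actW g \<psi>) y)
      = (\<Sum>y\<in>carrier G. X \<psi> (inv\<^bsub>G\<^esub> g \<otimes>\<^bsub>G\<^esub> y) - Y \<psi> (inv\<^bsub>G\<^esub> g \<otimes>\<^bsub>G\<^esub> y))"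
    by (rule sum.cong) (simp_all only: X_act[OF assms] Y_act[OF assms])
  also have "\<dots> = (\<Sum>y\<in>carrier G. X \<psi> y - Y \<psi> y)"
    using sum_left_mult[of "inv\<^bsub>G\<^esub> g" "\<lambda>y. X \<psi> y - Y \<psi> y"] assms by simp
  finally have s: "(\<Sum>y\<in>carrier G. X (actW g \<psi>) y - Y (actW g \<psi>) y) = (\<Sum>y\<in>carrier G. X \<psi> y - Y \<psi> y)" .
  show ?thesis
  proof
    fix q :: "nat \<times> int \<times> int"
    obtain n x where q: "q = (n, x)" by (cases q)
    show "iota (actW g \<psi>) q = translate G g (iota \<psi>) q"
    proof (cases "x \<in> carrier G")
      case True
      then have "inv\<^bsub>G\<^esub> g \<otimes>\<^bsub>G\<^esub> x \<in> carrier G" using assms by simp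
      then show ?thesis using True assms
        unfolding q iota_def translate_def prod.case s by (simp add: X_act Y_act m_assoc)
    qed (simp add: q iota_def translate_def)
  qed
qed

lemma proj_off: "n \<notin> {0, 1} \<or> x \<notin> carrier G \<Longrightarrow> proj l f (n, x) = 0"
  by (auto simp: proj_def)

text \<open>Summing over all \<open>v\<close> in the four-group removes the dependence on
  \<open>e\<close> and \<open>k\<close>; only the first two terms still see them, and they see only
  the coset of \<open>tz\<close>.\<close>

lemma proj_0:
  assumes "f \<in> R"
  shows "proj l f (0, el j e k) = f (0, el j e k) + f (0, el j (\<not> e) (\<not> k))
    + (\<Sum>i\<in>{1..<m}. of_bool (odd i) * (f (0, el (j + int i) False False) + f (0, el (j + int i) False True)
        + f (0, el (j - int i) True False) + f (0, el (j - int i) True True)))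
    + f (1, el j False False) + f (1, el j True False) - f (2, \<one>\<^bsub>G\<^esub>)"
proof -
  have b: "f (1, el j e True) = f (1, el j e False)" for j e using assms unfolding R_iff by blast
  have n: "f (2, el j e k) = f (2, \<one>\<^bsub>G\<^esub>)" for j e k using assms unfolding R_iff by (meson el_carrier)
  have b': "f (1, el j e k) + f (1, el j (\<not> e) k) = f (1, el j False False) + f (1, el j True False)"
    using b by (cases e; cases k) auto
  have "f (0, el j e k \<otimes>\<^bsub>G\<^esub> el (int i) False False) + f (0, el j e k \<otimes>\<^bsub>G\<^esub> el (int i) False True)
          + f (0, el j e k \<otimes>\<^bsub>G\<^esub> el (- int i) True False) + f (0, el j e k \<otimes>\<^bsub>G\<^esub> el (- int i) True True)
      = f (0, el (j + int i) False False) + f (0, el (j + int i) False True)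
        + f (0, el (j - int i) True False) + f (0, el (j - int i) True True)" for i
    by (cases e; cases k) (simp_all add: el_mult add.commute add.left_commute)
  then show ?thesis using b' by (simp add: proj_def el_mult_0 n)
qed

text \<open>Right multiplication by powers of \<open>s\<close> runs through a full period of the
  first coordinate, forwards or backwards according to \<open>e\<close>; either way the sum is
  independent of \<open>j\<close>.\<close>

lemma proj_1:
  assumes "f \<in> R"
  shows "proj l f (1, el j e k) = l * (\<Sum>y\<in>carrier G. f (0, y))
    + (\<Sum>i\<in>{0..<int m}. f (1, el i e False)) - 2 * l * f (2, \<one>\<^bsub>G\<^esub>)"
proof -
  have b: "f (Suc 0, el j e k) = f (Suc 0, el j e False)" for j e k
  proof -
    have "f (1, el j e True) = f (1, el j e False)" using assms unfolding R_iff by blast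
    then show ?thesis by (cases k) auto
  qed
  have n: "f (2, el j e k) = f (2, \<one>\<^bsub>G\<^esub>)" for j e k using assms unfolding R_iff by (meson el_carrier)
  have "(\<Sum>i\<in>{0..<int m}. f (1, el j e k \<otimes>\<^bsub>G\<^esub> el i False False)) = (\<Sum>i\<in>{0..<int m}. f (1, el i e False))"
  proof (cases e)
    case True
    have "(\<Sum>i\<in>{0..<int m}. f (1, el (j - i) True False)) = (\<Sum>i\<in>{0..<int m}. f (1, el (j + i) True False))"
      using sum_periodic_neg[of "\<lambda>i. f (1, el (j + i) True False)" "int m"]
      by (simp add: el_period flip: add.assoc)
    also have "\<dots> = (\<Sum>i\<in>{0..<int m}. f (1, el i True False))"
      using sum_periodic_shift[of "\<lambda>i. f (1, el i True False)" "int m" j] by (simp add: el_period add.commute)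
    finally show ?thesis using True by (simp add: el_mult b[where k = k])
  next
    case False
    then show ?thesis
      using sum_periodic_shift[of "\<lambda>i. f (1, el i False False)" "int m" j]
      by (simp add: el_mult b[where k = k] el_period add.commute)
  qed
  then show ?thesis by (simp add: proj_def n)
qed

lemma proj_mem:
  assumes "f \<in> R"
  shows "proj l f \<in> F"
  unfolding F_iff
proof (intro conjI allI impI)
  fix n :: nat and x assume "n \<notin> {0, 1} \<or> x \<notin> carrier G"
  then show "proj l f (n, x) = 0" by (rule proj_off)
qed (simp_all only: proj_0[OF assms] proj_1[OF assms] not_not add.commute)

lemma proj_add: "proj l (f + f') = proj l f + proj l f'"
  by (auto simp: proj_def fun_eq_iff sum.distrib algebra_simps)

lemma proj_equivariant:
  assumes "g \<in> carrier G"
  shows "proj l (translate G g f) = translate G g (proj l f)"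
proof
  fix q :: "nat \<times> int \<times> int"
  obtain n x where q: "q = (n, x)" by (cases q)
  have s: "(\<Sum>y\<in>carrier G. translate G g f (0, y)) = (\<Sum>y\<in>carrier G. f (0, y))"
    using sum_left_mult[of "inv\<^bsub>G\<^esub> g" "\<lambda>y. f (0, y)"] assms by (simp add: translate_def)
  show "proj l (translate G g f) q = translate G g (proj l f) q"
  proof (cases "x \<in> carrier G")
    case True
    then have "inv\<^bsub>G\<^esub> g \<otimes>\<^bsub>G\<^esub> x \<in> carrier G" using assms by simp
    then show ?thesis using True assms s
      unfolding q proj_def by (simp add: translate_def m_assoc)
  qed (simp add: q proj_def translate_def)
qed

section \<open>The kernel of \<open>iota\<close> and the vanishing of the composition\<close>

lemma sum_alternating_signs: "(\<Sum>i\<in>{1..<m}. (- 1 :: int) ^ i) = 0"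
proof -
  \<comment> \<open>Telescoping the constant function 1 gives twice the sum on one side and
    \<open>1 - 1\<close> on the other.\<close>
  have "2 * (\<Sum>i\<in>{1..<m}. (- 1 :: int) ^ i) = 0"
    using sum_alternating_telescope[OF odd_m, of "\<lambda>_. 1" 0] by (simp add: sum_distrib_left mult.commute)
  then show ?thesis by simp
qed

lemma fun_eq_0I:
  assumes "f \<in> R \<or> f \<in> F" and "\<And>n j e k. n \<in> {0, 1, 2} \<Longrightarrow> f (n, el j e k) = 0"
  shows "f = 0"
proof
  fix q :: "nat \<times> int \<times> int"
  obtain n x where q: "q = (n, x)" by (cases q)
  show "f q = 0 q"
  proof (cases "n \<in> {0, 1, 2} \<and> x \<in> carrier G")
    case True
    then show ?thesis using assms(2) by (auto simp: q elim!: carrierE)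
  next
    case False
    then show ?thesis using assms(1) unfolding q R_iff F_iff zero_fun_apply by blast
  qed
qed

lemma iota_const: "iota (\<lambda>q. if q \<in> P then c else 0) = 0"
proof -
  have X: "X (\<lambda>q. if q \<in> P then c else 0) (el j e k) = c"
    and Y: "Y (\<lambda>q. if q \<in> P then c else 0) (el j e k) = c" for j e k
    using P_mem[of "el j e k"] unfolding X_def Y_def by auto
  show ?thesis
  proof (rule fun_eq_0I)
    fix n j e k assume "n \<in> {0, 1, 2 :: nat}"
    then consider "n = 0" | "n = 1" | "n = 2" by blast
    then show "iota (\<lambda>q. if q \<in> P then c else 0) (n, el j e k) = 0"
      using sum_alternating_signs
      by cases (simp_all only: iota_0 iota_1 iota_2 el_carrier X Y flip: sum_distrib_right, simp_all)
  qed (use iota_mem in blast)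
qed

text \<open>Vanishing at index 0 equates \<open>X\<close>, which ignores \<open>k\<close>, with
  \<open>Y\<close>, which ignores \<open>e\<close>; both then depend on \<open>j\<close> alone.
  Vanishing at index 1 says that \<open>U\<close> kills this function, and
  \<open>U (1 + S) = 1 - S\<close> makes it constant.\<close>

lemma iota_kernel:
  assumes "iota \<psi> = 0"
  shows "\<exists>c. \<forall>q\<in>P. \<psi> q = c"
proof -
  define \<omega> where "\<omega> j = X \<psi> (el j False False)" for j
  have "X \<psi> (el j e False) = Y \<psi> (el j False k)" for j e k
    using iota_0[of \<psi> j e k] assms by simp
  then have Xo: "X \<psi> (el j e k) = \<omega> j" and Yo: "Y \<psi> (el j e k) = \<omega> j" for j e k
    using X_el[of \<psi> j e k] Y_el[of \<psi> j e k] unfolding \<omega>_def by metis+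
  have U: "(\<Sum>i\<in>{1..<m}. (- 1) ^ i * \<omega> (j + int i)) = 0" for j
    using iota_1[of \<psi> j False False] assms by (simp add: Xo)
  have "\<omega> (j + 1) = \<omega> j" for j
  proof -
    have "\<omega> (j + int m) - \<omega> (j + 1) = (\<Sum>i\<in>{1..<m}. (- 1) ^ i * (\<omega> (j + int i) + \<omega> (j + int i + 1)))"
      by (rule sum_alternating_telescope[OF odd_m, symmetric])
    also have "\<dots> = 0" using U[of j] U[of "j + 1"] by (simp add: algebra_simps sum.distrib)
    finally show ?thesis by (simp add: \<omega>_def el_period)
  qed
  then have "\<omega> j = \<omega> 0" for j
    by (induction j rule: int_induct[where k = 0]) (auto, metis diff_add_cancel)
  then have "X \<psi> x = \<omega> 0 \<and> Y \<psi> x = \<omega> 0" if "x \<in> carrier G" for x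
    using that Xo Yo by (metis carrierE)
  then have "\<psi> q = \<omega> 0" if "q \<in> P" for q
    using that by (metis P_cases)
  then show ?thesis by blast
qed

text \<open>At index 0 the terms combine into full cyclic sums of \<open>X\<close> and
  \<open>Y\<close>, whose total \<open>N\<close> is cancelled by the third component. At index 1 the
  sums of \<open>U X\<close> vanish, and \<open>2 * N\<close> from the first component cancels
  against the last term.\<close>

lemma proj_iota: "proj l (iota \<psi>) = 0"
proof (rule fun_eq_0I)
  fix n j e k assume n: "n \<in> {0, 1, 2 :: nat}"
  define xs where "xs j e = X \<psi> (el j e False)" for j e
  define ys where "ys j k = Y \<psi> (el j False k)" for j k
  have perx: "xs (j + int m) e = xs j e" and pery: "ys (j + int m) e = ys j e" for j e
    by (simp_all add: xs_def ys_def el_period)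
  define N where "N = (\<Sum>j\<in>{0..<int m}. xs j False + xs j True - ys j False - ys j True)"
  have a: "iota \<psi> (0, el j e k) = xs j e - ys j k" for j e k
    unfolding xs_def ys_def by (rule iota_0)
  have b: "iota \<psi> (1, el j e k) = (\<Sum>i\<in>{1..<m}. (- 1) ^ i * xs (if e then j - int i else j + int i) e)" for j e k
    unfolding xs_def by (rule iota_1)
  have N: "iota \<psi> (2, \<one>\<^bsub>G\<^esub>) = N" unfolding N_def xs_def ys_def by (rule iota_2) simp
  \<comment> \<open>The weight is 1 for every \<open>i\<close>: \<open>2 - 1\<close> at odd shifts
    and \<open>0 + 1\<close> at even ones. The 2 arises because \<open>X\<close> ignores
    \<open>k\<close>, so the four-group sum counts each of its values twice; the sign comes from
    \<open>U\<close>.\<close>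
  have cyc: "g j + (\<Sum>i\<in>{1..<m}. (2 * of_bool (odd i) + (- 1) ^ i) * g (j + int i)) = (\<Sum>i\<in>{0..<int m}. g i)"
    if g: "\<And>j. g (j + int m) = g j" for g :: "int \<Rightarrow> int" and j
  proof -
    have "(\<Sum>i\<in>{1..<m}. (2 * of_bool (odd i) + (- 1) ^ i) * g (j + int i)) = (\<Sum>i\<in>{1..<m}. g (j + int i))"
      by (rule sum.cong) auto
    also have "g j + \<dots> = (\<Sum>i\<in>{0..<m}. g (j + int i))"
      using m_pos by (simp add: sum.atLeast_Suc_lessThan)
    also have "\<dots> = (\<Sum>i\<in>{0..<int m}. g (i + j))"
      by (rule sum.reindex_bij_witness[of _ nat int]) (auto simp: add.commute)
    also have "\<dots> = (\<Sum>i\<in>{0..<int m}. g i)" by (rule sum_periodic_shift) (rule g)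
    finally show ?thesis .
  qed
  consider "n = 0" | "n = 1" | "n = 2" using n by blast
  then show "proj l (iota \<psi>) (n, el j e k) = 0"
  proof cases
    case 1
    have xF: "xs j False + (\<Sum>i\<in>{1..<m}. (2 * of_bool (odd i) + (- 1) ^ i) * xs (j + int i) False)
        = (\<Sum>i\<in>{0..<int m}. xs i False)"
      by (rule cyc) (rule perx)
    \<comment> \<open>For \<open>e = True\<close> the shifts run backwards, so the cyclic identity
      is applied to the reflected function.\<close>
    have per': "xs (- (i + int m)) True = xs (- i) True" for i
      using perx[of "- i - int m" True] by simp
    have "xs j True + (\<Sum>i\<in>{1..<m}. (2 * of_bool (odd i) + (- 1) ^ i) * xs (j - int i) True)
        = (\<Sum>i\<in>{0..<int m}. xs (- i) True)"
      using cyc[of "\<lambda>i. xs (- i) True" "- j"] per' by simp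
    also have "\<dots> = (\<Sum>i\<in>{0..<int m}. xs i True)"
      using sum_periodic_neg[of "\<lambda>i. xs i True"] perx by simp
    finally have xT: "xs j True + (\<Sum>i\<in>{1..<m}. (2 * of_bool (odd i) + (- 1) ^ i) * xs (j - int i) True)
        = (\<Sum>i\<in>{0..<int m}. xs i True)" .
    \<comment> \<open>\<open>U\<close> does not involve \<open>Y\<close>; here the terms with and
      without \<open>t\<close> supply the shifts in both directions.\<close>
    have "ys j False + ys j True + (\<Sum>i\<in>{1..<m}. of_bool (odd i) * ((ys (j + int i) False + ys (j + int i) True)
        + (ys (j - int i) False + ys (j - int i) True))) = (\<Sum>i\<in>{0..<int m}. ys (j + i) False + ys (j + i) True)"
      using sum_odd_symmetric[OF odd_m, of "\<lambda>j. ys j False + ys j True" j] pery by simp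
    also have "\<dots> = (\<Sum>i\<in>{0..<int m}. ys i False + ys i True)"
      using sum_periodic_shift[of "\<lambda>j. ys j False + ys j True" "int m" j] pery by (simp add: add.commute)
    finally have y: "ys j False + ys j True + (\<Sum>i\<in>{1..<m}. of_bool (odd i) * ((ys (j + int i) False + ys (j + int i) True)
        + (ys (j - int i) False + ys (j - int i) True))) = (\<Sum>i\<in>{0..<int m}. ys i False + ys i True)" .
    have q: "xs j e - ys j k + (xs j (\<not> e) - ys j (\<not> k)) = xs j False + xs j True - (ys j False + ys j True)"
      by (cases e; cases k) auto
    have "(\<Sum>i\<in>{1..<m}. of_bool (odd i) * (xs (j + int i) False - ys (j + int i) False + (xs (j + int i) False - ys (j + int i) True)
          + (xs (j - int i) True - ys (j - int i) False) + (xs (j - int i) True - ys (j - int i) True)))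
        + (\<Sum>i\<in>{1..<m}. (- 1) ^ i * xs (j + int i) False) + (\<Sum>i\<in>{1..<m}. (- 1) ^ i * xs (j - int i) True)
      = (\<Sum>i\<in>{1..<m}. (2 * of_bool (odd i) + (- 1) ^ i) * xs (j + int i) False)
        + (\<Sum>i\<in>{1..<m}. (2 * of_bool (odd i) + (- 1) ^ i) * xs (j - int i) True)
        - (\<Sum>i\<in>{1..<m}. of_bool (odd i) * ((ys (j + int i) False + ys (j + int i) True)
        + (ys (j - int i) False + ys (j - int i) True)))"
      unfolding sum.distrib[symmetric] sum_subtractf[symmetric]
      by (rule sum.cong) (simp_all add: algebra_simps)
    moreover have "N = (\<Sum>i\<in>{0..<int m}. xs i False) + (\<Sum>i\<in>{0..<int m}. xs i True)
        - (\<Sum>i\<in>{0..<int m}. ys i False + ys i True)"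
      unfolding N_def sum.distrib[symmetric] sum_subtractf[symmetric]
      by (rule sum.cong) simp_all
    ultimately show ?thesis
      unfolding 1 proj_0[OF iota_mem] a b N q using xF xT y by simp
  next
    case 2
    have sh: "(\<Sum>j\<in>{0..<int m}. xs (if e then j - int i else j + int i) e) = (\<Sum>j\<in>{0..<int m}. xs j e)" for i
      using sum_periodic_shift[of "\<lambda>j. xs j e" "int m" "if e then - int i else int i"] perx
      by (cases e) auto
    have "(\<Sum>j\<in>{0..<int m}. \<Sum>i\<in>{1..<m}. (- 1) ^ i * xs (if e then j - int i else j + int i) e)
      = (\<Sum>i\<in>{1..<m}. (- 1) ^ i * (\<Sum>j\<in>{0..<int m}. xs (if e then j - int i else j + int i) e))"
      unfolding sum_distrib_left by (rule sum.swap)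
    \<comment> \<open>The inner sum over a full period does not depend on \<open>i\<close>, so the
      alternating signs cancel.\<close>
    also have "\<dots> = 0"
      unfolding sh using sum_alternating_signs by (simp flip: sum_distrib_right)
    finally have B: "(\<Sum>j\<in>{0..<int m}. iota \<psi> (1, el j e False)) = 0" unfolding b .
    have "(\<Sum>y\<in>carrier G. iota \<psi> (0, y)) = 2 * N"
      unfolding sum_carrier a N_def sum_distrib_left by (rule sum.cong) simp_all
    then show ?thesis unfolding 2 proj_1[OF iota_mem] B N by simp
  qed (simp add: proj_off)
qed (use proj_mem[OF iota_mem] in blast)

section \<open>Exactness\<close>

text \<open>First an element of \<open>W\<close> is subtracted off to make component 0 vanish. The
  remaining equations force \<open>n = 0\<close>, and what is left at index 1 is inverted through an
  antiderivative.\<close>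

lemma proj_kernel:
  assumes unit: "(int m - 4 * l) * \<delta> = 1" and f: "f \<in> R" and ker: "proj l f = 0"
  shows "\<exists>\<psi>\<in>W. iota \<psi> = f"
proof -
  \<comment> \<open>One solution of \<open>X - Y = f\<close> at index 0, normalised by
    \<open>xs j False = 0\<close>. It matches at \<open>e = k = True\<close> only if the mixed
    difference of \<open>f\<close> in \<open>e\<close> and \<open>k\<close> vanishes.\<close>
  define xs where "xs j e = f (0, el j e False) - f (0, el j False False)" for j e
  define ys where "ys j k = - f (0, el j False k)" for j k
  have "xs (j + int m) = xs j" "ys (j + int m) = ys j" for j
    by (simp_all add: xs_def ys_def fun_eq_iff el_period)
  then obtain \<psi>0 where psi0: "\<psi>0 \<in> W" and X0: "\<And>j e k. X \<psi>0 (el j e k) = xs j e"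
    and Y0: "\<And>j e k. Y \<psi>0 (el j e k) = ys j k"
    using ex_W[of xs ys] by blast
  define f' where "f' = f - iota \<psi>0"
  have f': "f' \<in> R" unfolding f'_def by (rule coset_fun_lattice_diff[OF f iota_mem])
  have f_eq: "f = f' + iota \<psi>0" by (simp add: f'_def)
  have ker': "proj l f' = 0"
  proof -
    have "proj l f = proj l f' + proj l (iota \<psi>0)" unfolding f_eq by (rule proj_add)
    then show ?thesis using ker by (simp add: proj_iota)
  qed
  have a0: "f' (0, el j e k) = 0" for j e k
  proof -
    \<comment> \<open>This is the mixed difference: the two values of \<open>proj\<close> share
      every term except the first two.\<close>
    have "f (0, el j e False) + f (0, el j (\<not> e) True) = f (0, el j e True) + f (0, el j (\<not> e) False)" for e
      using proj_0[OF f, of l j e False] proj_0[OF f, of l j e True] ker by simp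
    from this[of True] show ?thesis
      by (cases e; cases k) (simp_all add: f'_def iota_0 X0 Y0 xs_def ys_def)
  qed
  define n where "n = f' (2, \<one>\<^bsub>G\<^esub>)"
  define b where "b j e = f' (1, el j e False)" for j e
  have bper: "b (j + int m) e = b j e" for j e by (simp add: b_def el_period)
  have bsum: "b j False + b j True = n" for j
    using proj_0[OF f', of l j False False] unfolding ker' a0 b_def n_def by simp
  have btot: "(\<Sum>j\<in>{0..<int m}. b j e) = 2 * l * n" for e
  proof -
    have "(\<Sum>y\<in>carrier G. f' (0, y)) = 0" by (simp add: sum_carrier a0)
    then show ?thesis using proj_1[OF f', of l 0 e False] unfolding ker' b_def n_def by simp
  qed
  \<comment> \<open>Summing \<open>bsum\<close> over a period and comparing with \<open>btot\<close>
    gives \<open>m n = 4 l n\<close>.\<close>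
  have n0: "n = 0"
  proof -
    have "int m * n = (\<Sum>j\<in>{0..<int m}. b j False + b j True)" by (simp add: bsum)
    also have "\<dots> = 4 * l * n" by (simp add: sum.distrib btot)
    finally have "(int m - 4 * l) * n = 0" by (simp add: algebra_simps)
    moreover have "int m - 4 * l \<noteq> 0" using unit by auto
    ultimately show ?thesis by simp
  qed
  \<comment> \<open>With \<open>b = (1 - S) \<beta>\<close> on the part \<open>e = False\<close>,
    the function \<open>\<omega> = (1 + S) \<beta>\<close> satisfies \<open>U \<omega> = b\<close>.
    Using \<open>\<omega>\<close> for both \<open>X\<close> and \<open>Y\<close> keeps component 0
    zero.\<close>
  obtain \<beta> where bper': "\<And>j. \<beta> (j + int m) = \<beta> j" and beta: "\<And>j. \<beta> j - \<beta> (j + 1) = b j False"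
    using periodic_antiderivative[of "int m" "\<lambda>j. b j False"] m_pos bper btot[of False] n0 by auto
  define \<omega> where "\<omega> j = \<beta> j + \<beta> (j + 1)" for j
  have oper: "\<omega> (j + int m) = \<omega> j" for j
    using bper'[of j] bper'[of "j + 1"] by (simp add: \<omega>_def algebra_simps)
  obtain \<psi>1 where psi1: "\<psi>1 \<in> W" and X1: "\<And>j e k. X \<psi>1 (el j e k) = \<omega> j"
    and Y1: "\<And>j e k. Y \<psi>1 (el j e k) = \<omega> j"
    using ex_W[of "\<lambda>j _. \<omega> j" "\<lambda>j _. \<omega> j"] oper by (auto simp: fun_eq_iff)
  have U: "(\<Sum>i\<in>{1..<m}. (- 1) ^ i * \<omega> (j + int i)) = b j False" for j
    using sum_alternating_telescope[OF odd_m, of \<beta> j] beta[of j] bper'[of j] by (simp add: \<omega>_def)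
  have "iota \<psi>1 - f' = 0"
  proof (rule fun_eq_0I)
    show "iota \<psi>1 - f' \<in> R \<or> iota \<psi>1 - f' \<in> F"
      using coset_fun_lattice_diff[OF iota_mem f'] by blast
  next
    fix i j e k assume "i \<in> {0, 1, 2 :: nat}"
    then consider "i = 0" | "i = 1" | "i = 2" by blast
    then show "(iota \<psi>1 - f') (i, el j e k) = 0"
    proof cases
      case 1
      then show ?thesis by (simp add: iota_0 X1 Y1 a0)
    next
      case 2
      have "f' (1, el j e True) = f' (1, el j e False)" using f' unfolding R_iff by blast
      then have "f' (1, el j e k) = b j e" unfolding b_def by (cases k) auto
      moreover have "iota \<psi>1 (1, el j e k) = b j e"
      proof (cases e)
        case True
        \<comment> \<open>This sign agrees with the one that \<open>U\<close> acquires under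
          reflection, so the same \<open>\<omega>\<close> also serves
          \<open>e = True\<close>.\<close>
        have "b j True = - b j False" using bsum[of j] n0 by simp
        then show ?thesis
          using sum_alternating_reflect[where \<omega> = \<omega> and j = j, OF odd_m oper] U[of j] True
          unfolding iota_1 X1 by simp
      next
        case False
        then show ?thesis using U[of j] unfolding iota_1 X1 by simp
      qed
      ultimately show ?thesis by (simp add: 2)
    next
      case 3
      have "f' (2, el j e k) = n" using f' unfolding R_iff n_def by (meson el_carrier)
      then show ?thesis using n0 by (simp add: 3 iota_2 X1 Y1)
    qed
  qed
  then have "iota (\<psi>1 + \<psi>0) = f" unfolding iota_add f_eq by simp
  moreover have "\<psi>1 + \<psi>0 \<in> W" using psi0 psi1 by (simp add: perm_sum_lattice_def)
  ultimately show ?thesis by blast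
qed

text \<open>A first element \<open>f0\<close> makes the target at index 0 depend on \<open>j\<close>
  alone; \<open>f1\<close>, with zero component at index 0, then solves the rest. The unit
  \<open>\<delta>\<close> makes the linear equation for \<open>n\<close> solvable over the
  integers.\<close>

lemma proj_surj:
  assumes unit: "(int m - 4 * l) * \<delta> = 1" and t: "t \<in> F"
  shows "\<exists>f\<in>R. proj l f = t"
proof -
  have tA: "t (0, el j (\<not> e) (\<not> k)) = t (0, el j e k)" for j e k
    using t unfolding F_iff by blast
  \<comment> \<open>For each \<open>j\<close> the target takes two values at index 0, one per coset
    of \<open>tz\<close>. A function supported on the powers of \<open>s\<close> can produce any
    prescribed difference between them, since all other terms of \<open>proj\<close> agree.\<close>
  have "\<exists>h. \<forall>j e k. h (el j e k) = (if e \<or> k then 0 else t (0, el j False False) - t (0, el j False True))"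
    by (rule ex_fun_el) (simp only: el_period)
  then obtain h where h: "\<And>j e k. h (el j e k) = (if e \<or> k then 0 else t (0, el j False False) - t (0, el j False True))"
    by blast
  define f0 where "f0 = (\<lambda>(n :: nat, x). if n = 0 \<and> x \<in> carrier G then h x else 0)"
  have f0: "f0 \<in> R" unfolding R_iff by (simp add: f0_def)
  define u where "u = t - proj l f0"
  have uF: "u \<in> F" unfolding u_def by (rule coset_fun_lattice_diff[OF t proj_mem[OF f0]])
  have uA: "u (0, el j (\<not> e) (\<not> k)) = u (0, el j e k)" and uC: "u (1, el j e k) = u (1, el 0 e False)" for j e k
    using uF unfolding F_iff by blast+
  have "u (0, el j False True) = u (0, el j False False)" for j
    using tA[of j False False] tA[of j False True]
    unfolding u_def minus_apply proj_0[OF f0] by (simp add: f0_def h)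
  then have uA': "u (0, el j e k) = u (0, el j False False)" for j e k
    using uA[of j False False] uA[of j False True] by (cases e; cases k) auto
  define A where "A j = u (0, el j False False)" for j
  define C where "C e = u (1, el 0 e False)" for e
  \<comment> \<open>The conditions on \<open>b\<close> are
    \<open>b j False + b j True = A j + n\<close> and column sums \<open>C e + 2 * l * n\<close>.
    Summing them gives \<open>(m - 4 l) n = C False + C True - sum A\<close>.\<close>
  define n where "n = \<delta> * (C False + C True - (\<Sum>j\<in>{0..<int m}. A j))"
  have n: "(int m - 4 * l) * n = C False + C True - (\<Sum>j\<in>{0..<int m}. A j)"
    unfolding n_def mult.assoc[symmetric] unit by simp
  \<comment> \<open>The column \<open>e = True\<close> is concentrated in the class of 0 modulo
    \<open>m\<close>, carrying its whole prescribed sum there; the other column is then determined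
    by the row condition.\<close>
  define b where "b j e = (if e then of_bool (int m dvd j) * (C True + 2 * l * n)
    else A j + n - of_bool (int m dvd j) * (C True + 2 * l * n))" for j e
  have bT: "(\<Sum>j\<in>{0..<int m}. b j True) = C True + 2 * l * n"
  proof -
    have "(\<Sum>j\<in>{0..<int m}. b j True) = (\<Sum>j\<in>{0..<int m}. if j = 0 then C True + 2 * l * n else 0)"
      by (rule sum.cong) (auto simp: b_def zdvd_not_zless dest: zdvd_imp_le)
    then show ?thesis using m_pos by simp
  qed
  have bFT: "b j False + b j True = A j + n" for j by (simp add: b_def)
  have bF: "(\<Sum>j\<in>{0..<int m}. b j False) = C False + 2 * l * n"
  proof -
    have "(\<Sum>j\<in>{0..<int m}. b j False) + (\<Sum>j\<in>{0..<int m}. b j True) = (\<Sum>j\<in>{0..<int m}. A j + n)"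
      unfolding sum.distrib[symmetric] bFT ..
    also have "\<dots> = (\<Sum>j\<in>{0..<int m}. A j) + int m * n" by (simp add: sum.distrib)
    finally show ?thesis using n bT by (simp add: algebra_simps)
  qed
  have "b (j + int m) e = b j e" for j e by (cases e) (simp_all add: b_def A_def el_period)
  then have "\<exists>g. \<forall>j e k. g (el j e k) = b j e" by (intro ex_fun_el) simp
  then obtain g where g: "\<And>j e k. g (el j e k) = b j e" by blast
  define f1 where "f1 = (\<lambda>(i :: nat, x). if x \<notin> carrier G then 0 else if i = 1 then g x else if i = 2 then n else 0)"
  have f1: "f1 \<in> R" unfolding R_iff by (simp add: f1_def g)
  have "u - proj l f1 = 0"
  proof (rule fun_eq_0I)
    show "u - proj l f1 \<in> R \<or> u - proj l f1 \<in> F"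
      using coset_fun_lattice_diff[OF uF proj_mem[OF f1]] by blast
  next
    fix i j e k assume "i \<in> {0, 1, 2 :: nat}"
    then consider "i = 0" | "i = 1" | "i = 2" by blast
    then show "(u - proj l f1) (i, el j e k) = 0"
    proof cases
      case 1
      have "u (0, el j e k) = A j" using uA'[of j e k] by (simp add: A_def)
      then show ?thesis using bFT[of j] unfolding 1 minus_apply proj_0[OF f1] by (simp add: f1_def g)
    next
      case 2
      have "u (1, el j e k) = C e" using uC[of j e k] by (simp add: C_def)
      then show ?thesis using bF bT unfolding 2 minus_apply proj_1[OF f1] by (cases e) (simp_all add: f1_def g)
    next
      case 3
      have "(2 :: nat) \<notin> {0, 1}" by simp
      then have "u (2, el j e k) = 0" using uF unfolding F_iff by blast
      then show ?thesis by (simp add: 3 proj_off)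
    qed
  qed
  then have "proj l (f0 + f1) = t" unfolding proj_add u_def by (simp add: algebra_simps)
  moreover have "f0 + f1 \<in> R" by (rule coset_fun_lattice_add[OF f0 f1])
  ultimately show ?thesis by blast
qed

lemma quasi_permutation_dihedral:
  "quasi_permutation G (J_lattice G {HZ, HT}) (J_act G {HZ, HT})"
proof -
  \<comment> \<open>The multiple \<open>4 * l\<close> is the one nearest to the odd number
    \<open>m\<close>, so the difference is 1 or \<open>- 1\<close> and is its own inverse.\<close>
  obtain l \<delta> :: int where unit: "(int m - 4 * l) * \<delta> = 1"
  proof (cases "m mod 4 = 1")
    case True
    then have "int m = 4 * int (m div 4) + 1" by presburger
    then show ?thesis using that[of "int (m div 4)" 1] by simp
  next
    case False
    then have "int m = 4 * int (m div 4) + 3" using odd_m by presburger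
    then show ?thesis using that[of "int (m div 4) + 1" "- 1"] by simp
  qed
  show ?thesis
  proof (rule quasi_permutation_J[OF permutation_lattice_R permutation_lattice_F])
    show "G_hom G W actW R (translate G) iota"
      unfolding G_hom_def using iota_mem iota_add iota_equivariant by blast
    show "G_hom G R (translate G) F (translate G) (proj l)"
      unfolding G_hom_def using proj_mem proj_add proj_equivariant by blast
    show "proj l ` R = F" using proj_mem proj_surj[OF unit] by blast
    show "iota ` W = {y \<in> R. proj l y = 0}" using iota_mem proj_iota proj_kernel[OF unit] by blast
    show "\<And>c. iota (\<lambda>q. if q \<in> P then c else 0) = 0" by (rule iota_const)
    show "\<And>\<psi>. \<psi> \<in> W \<Longrightarrow> iota \<psi> = 0 \<Longrightarrow> \<exists>c. \<forall>q\<in>P. \<psi> q = c" by (rule iota_kernel)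
  qed
qed

end

theorem theorem7p1:
  fixes m :: nat
  assumes "odd m" and "m > 0"
  shows "quasi_permutation (dihedral (2 * m))
           (J_lattice (dihedral (2 * m))
              {generate (dihedral (2 * m)) {dih_sigma (2 * m) [^]\<^bsub>dihedral (2 * m)\<^esub> m},
               generate (dihedral (2 * m)) {dih_tau (2 * m)}})
           (J_act (dihedral (2 * m))
              {generate (dihedral (2 * m)) {dih_sigma (2 * m) [^]\<^bsub>dihedral (2 * m)\<^esub> m},
               generate (dihedral (2 * m)) {dih_tau (2 * m)}})"
proof -
  interpret odd_dihedral m using assms(1) by unfold_locales
  show ?thesis unfolding generate_sigma_pow generate_tau by (rule quasi_permutation_dihedral)
qed

end
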